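(* For all integers $n,m,R$ with $1\le m\le n$ and $0\le R\le n$, there exist a circuit $\mathcal{C}\subset\mathbb{Z}^n$ with $m(\mathcal{C})=m$ and $\mathrm{rk}(\bar{\mathcal{C}})=R$, and a generic real polynomial system supported on $\mathcal{C}$ whose number $N$ of real solutions satisfies: $N=2^{\,n-R}(m+R+1)$ if $R\le m$, and $N=2^{\,n-R}(2m+1)$ if $R\ge m$.
   Context: A circuit is a set $\mathcal{C}\subset\mathbb{Z}^n$ of $n+2$ points whose affine span is $\mathbb{R}^n$; it contains a unique minimal affinely dependent subset, and $m(\mathcal{C})$ denotes the dimension of the affine span of that subset. The rank modulo $2$ of $\mathcal{C}$, $\mathrm{rk}(\bar{\mathcal{C}})$, is the rank over $\mathbb{Z}/2$ of the matrix whose columns are the reductions modulo $2$ of the vectors $w-w'$, $w\in\mathcal{C}$, for a fixed $w'\in\mathcal{C}$ (equivalently, after translating $\mathcal{C}$ so that $0\in\mathcal{C}$, of the nonzero elements of $\mathcal{C}$). A real polynomial system supported on $\mathcal{C}$ is a system of $n$ Laurent polynomial equations $F_1=\dots=F_n=0$ in $x=(x_1,\dots,x_n)$ with real coefficients, where each $F_j$ has support $\mathcal{C}$ (the set of exponent vectors of its monomials with nonzero coefficient). Such a system is generic if its number of solutions in $(\mathbb{C}^* )^n$ equals the normalized volume $v(\mathcal{C})$ of the convex hull of $\mathcal{C}$ (normalized so that $[0,1]^n$ has volume $n!$). Real solutions are solutions in $(\mathbb{R}^* )^n$. *)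

theory Defs
  imports "HOL-Analysis.Analysis"
begin

definition rvec :: "int^'n \<Rightarrow> real^'n" where
  "rvec w = (\<chi> i. of_int (w $ i))"

definition is_circuit :: "(int^'n::finite) set \<Rightarrow> bool" where
  "is_circuit C \<longleftrightarrow> finite C \<and> card C = CARD('n) + 2 \<and>
     affine hull (rvec ` C) = UNIV"

definition min_aff_dep :: "(int^'n::finite) set \<Rightarrow> (int^'n) set \<Rightarrow> bool" where
  "min_aff_dep C D \<longleftrightarrow> D \<subseteq> C \<and> affine_dependent (rvec ` D) \<and>
     (\<forall>D'. D' \<subset> D \<longrightarrow> \<not> affine_dependent (rvec ` D'))"

definition circuit_m :: "(int^'n::finite) set \<Rightarrow> int" where
  "circuit_m C = aff_dim (rvec ` (THE D. min_aff_dep C D))"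

definition red2 :: "int^'n \<Rightarrow> int^'n" where
  "red2 v = (\<chi> i. v $ i mod 2)"

text \<open>Linear independence over Z/2 of a set of reduced vectors: no nonempty
  subset sums to zero modulo 2 (over F_2 linear combinations are subset sums).\<close>
definition indep2 :: "(int^'n::finite) set \<Rightarrow> bool" where
  "indep2 S \<longleftrightarrow> (\<forall>T. T \<subseteq> S \<longrightarrow> T \<noteq> {} \<longrightarrow> (\<exists>i. odd (\<Sum>v\<in>T. v $ i)))"

text \<open>Rank mod 2 of C: rank over Z/2 of the matrix with columns (w - w') mod 2,
  i.e. the maximal size of an F_2-linearly independent set of columns.\<close>
definition rk2 :: "(int^'n::finite) set \<Rightarrow> nat" where
  "rk2 C = (let w' = (SOME w'. w' \<in> C); V = red2 ` ((\<lambda>w. w - w') ` C) in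
     Max {card S | S. S \<subseteq> V \<and> indep2 S})"

definition Feval :: "('n \<Rightarrow> int^'n \<Rightarrow> real) \<Rightarrow> (int^'n) set \<Rightarrow> 'n \<Rightarrow> 'a^'n \<Rightarrow> 'a::{real_field}"
  where "Feval c C j x = (\<Sum>w\<in>C. of_real (c j w) * (\<Prod>i\<in>UNIV. x $ i powi (w $ i)))"

definition supported_on :: "('n::finite \<Rightarrow> int^'n \<Rightarrow> real) \<Rightarrow> (int^'n) set \<Rightarrow> bool" where
  "supported_on c C \<longleftrightarrow> (\<forall>j w. c j w \<noteq> 0 \<longleftrightarrow> w \<in> C)"

definition complex_sols :: "('n::finite \<Rightarrow> int^'n \<Rightarrow> real) \<Rightarrow> (int^'n) set \<Rightarrow> (complex^'n) set" where
  "complex_sols c C = {x. (\<forall>i. x $ i \<noteq> 0) \<and> (\<forall>j. Feval c C j x = 0)}"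

definition real_sols :: "('n::finite \<Rightarrow> int^'n \<Rightarrow> real) \<Rightarrow> (int^'n) set \<Rightarrow> (real^'n) set" where
  "real_sols c C = {x. (\<forall>i. x $ i \<noteq> 0) \<and> (\<forall>j. Feval c C j x = 0)}"

definition norm_vol :: "(int^'n::finite) set \<Rightarrow> real" where
  "norm_vol C = fact CARD('n) * measure lborel (convex hull (rvec ` C))"

definition generic_system :: "('n::finite \<Rightarrow> int^'n \<Rightarrow> real) \<Rightarrow> (int^'n) set \<Rightarrow> bool" where
  "generic_system c C \<longleftrightarrow> finite (complex_sols c C) \<and>
     real (card (complex_sols c C)) = norm_vol C"

end

theory Submission
  imports Defs
begin

text \<open>
  The circuit consists of \<open>0\<close>, the points \<open>d i * e i\<close> with \<open>d i = 1\<close> for \<open>R\<close> of the indices and \<open>d i = 2\<close>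
  otherwise, and the point \<open>\<Sum>i. k i * d i * e i\<close> with \<open>k = 2\<close> on a set \<open>P\<close>, \<open>k = - 2\<close> on a set \<open>N\<close> and
  \<open>k = 0\<close> elsewhere, where \<open>P\<close> and \<open>N\<close> partition a set of \<open>m\<close> indices.  Up to an invertible
  recombination of the equations, the system reads \<open>x i ^ d i = 1 + b i * y\<close>, where \<open>y\<close> is the
  monomial of the last point.  Eliminating the \<open>x i\<close> leaves
  \<open>y * (\<Prod>i\<in>N. (1 + b i * y)\<^sup>2) = (\<Prod>i\<in>P. (1 + b i * y)\<^sup>2)\<close>, of degree \<open>max (2 |P|) (2 |N| + 1)\<close>.

  The parameters \<open>b i\<close> with \<open>i \<in> P \<union> N\<close> are chosen one after the other, each much smaller than the previous ones.
  For \<open>d i = 2\<close> they are positive and the indices go alternately to \<open>P\<close> and \<open>N\<close>, each adding one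
  positive root; for \<open>d i = 1\<close> they are negative, all on the side of larger degree, each adding two.
  Hence the degree is \<open>m + min m R + 1\<close>, all roots are real and positive, and \<open>1 + b i * y > 0\<close> at every
  root \<open>y\<close> whenever \<open>d i = 2\<close>.  So every complex solution is real, and there are \<open>2 ^ (n - R)\<close> of them
  for each root.  This is also the normalized volume, computed from the triangulation of the
  circuit all of whose simplices contain the origin.
\<close>

subsection \<open>Real-rooted polynomials\<close>

text \<open>The sign is normalised so that \<open>U\<close> is the larger polynomial at the last point.\<close>

definition alternating :: "real poly \<Rightarrow> real poly \<Rightarrow> nat \<Rightarrow> bool" where
  "alternating U W d \<longleftrightarrow> (\<exists>t::nat \<Rightarrow> real. 0 < t 0 \<and> (\<forall>j<d. t j < t (Suc j)) \<and>
     (\<forall>j\<le>d. 0 < (-1) ^ (d + j) * (poly U (t j) - poly W (t j))))"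

lemma poly_less_beyond:
  fixes U W :: "real poly"
  assumes "degree W < degree U" "0 < lead_coeff U"
  shows "\<exists>y>x. poly W y < poly U y"
proof -
  have "degree (U - W) = degree U"
    using degree_add_eq_left[of "- W" U] assms(1) by simp
  then have "lead_coeff (U - W) > 0"
    using assms by (simp add: coeff_eq_0)
  then obtain n where "\<forall>y\<ge>n. lead_coeff (U - W) \<le> poly (U - W) y"
    using poly_pinfty_gt_lc by blast
  with \<open>lead_coeff (U - W) > 0\<close> have "poly (U - W) (max n (x + 1)) > 0"
    by (meson less_le_trans max.cobounded1)
  then show ?thesis
    by (intro exI[of _ "max n (x + 1)"]) auto
qed

text \<open>The intermediate value theorem gives a root in each of the \<open>d\<close> gaps between
  consecutive sample points. The gaps are disjoint, so the roots are distinct, and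
  \<open>0 < t 0\<close> makes them positive.\<close>

lemma alternating_roots:
  assumes "alternating U W d"
  shows "\<exists>Y. finite Y \<and> card Y = d \<and> (\<forall>y\<in>Y. 0 < y \<and> poly U y = poly W y)"
proof -
  obtain t where t: "0 < t 0" "\<And>j. j < d \<Longrightarrow> t j < t (Suc j)"
    and sgn: "\<And>j. j \<le> d \<Longrightarrow> 0 < (-1) ^ (d + j) * (poly U (t j) - poly W (t j))"
    using assms unfolding alternating_def by blast
  have mono: "t i \<le> t j" if "i \<le> j" "j \<le> d" for i j
    using that
  proof (induction j)
    case (Suc j)
    then show ?case using t(2)[of j] by (cases "i = Suc j") auto
  qed simp
  have "\<exists>x. t j < x \<and> x < t (Suc j) \<and> poly (U - W) x = 0" if "j < d" for j
  proof -
    \<comment> \<open>The normalising powers of -1 at neighbouring indices are opposite, so this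
      positive product means that the two values have opposite signs.\<close>
    have "0 < ((-1) ^ (d + j) * poly (U - W) (t j)) * ((-1) ^ (d + Suc j) * poly (U - W) (t (Suc j)))"
      unfolding poly_diff using that by (intro mult_pos_pos sgn) auto
    also have "\<dots> = - (poly (U - W) (t j) * poly (U - W) (t (Suc j)))"
      by (cases "even (d + j)") (simp_all add: algebra_simps)
    finally show ?thesis
      using poly_IVT[of "t j" "t (Suc j)" "U - W"] t(2)[OF that] by auto
  qed
  then obtain r where r: "\<And>j. j < d \<Longrightarrow> t j < r j \<and> r j < t (Suc j) \<and> poly (U - W) (r j) = 0"
    by metis
  have less: "r i < r j" if "i < j" "j < d" for i j
    using r[of i] r[of j] mono[of "Suc i" j] that by fastforce
  have "inj_on r {..<d}"
    by (intro linorder_inj_onI') (auto dest: less)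
  moreover have "0 < r j" if "j < d" for j
    using r[OF that] t(1) mono[of 0 j] that by fastforce
  ultimately show ?thesis
    using r by (intro exI[of _ "r ` {..<d}"]) (auto simp: card_image)
qed

text \<open>A factor \<open>(1 + e x)\<^sup>2\<close> with small \<open>e > 0\<close> on the smaller side makes that side win near infinity,
  which creates one more sign change.\<close>

lemma alternating_kink:
  assumes "alternating U W d" "0 < lead_coeff W" "degree U < degree W + 2"
  shows "\<exists>e>0. alternating (W * [:1, e:]\<^sup>2) U (Suc d)"
proof -
  obtain t where t: "0 < t 0" "\<And>j. j < d \<Longrightarrow> t j < t (Suc j)"
    and sgn: "\<And>j. j \<le> d \<Longrightarrow> 0 < (-1) ^ (d + j) * (poly U (t j) - poly W (t j))"
    using assms(1) unfolding alternating_def by blast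
  \<comment> \<open>At \<open>e = 0\<close> these are finitely many strict inequalities that hold by
    assumption; continuity keeps them for small \<open>e\<close>.\<close>
  have "\<forall>\<^sub>F e in at_right 0. \<forall>j\<in>{..d}. 0 < (-1) ^ (d + j) * (poly U (t j) - poly W (t j) * (1 + e * t j)\<^sup>2)"
  proof (intro eventually_ball_finite ballI)
    fix j assume "j \<in> {..d}"
    have "((\<lambda>e. (-1) ^ (d + j) * (poly U (t j) - poly W (t j) * (1 + e * t j)\<^sup>2)) \<longlongrightarrow>
        (-1) ^ (d + j) * (poly U (t j) - poly W (t j) * (1 + 0 * t j)\<^sup>2)) (at_right 0)"
      by (intro tendsto_intros)
    then show "\<forall>\<^sub>F e in at_right 0. 0 < (-1) ^ (d + j) * (poly U (t j) - poly W (t j) * (1 + e * t j)\<^sup>2)"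
      using sgn[of j] \<open>j \<in> {..d}\<close> by (intro order_tendstoD(1)) auto
  qed simp
  then have "\<forall>\<^sub>F e in at_right 0. 0 < e \<and> (\<forall>j\<in>{..d}. 0 < (-1) ^ (d + j) * (poly U (t j) - poly W (t j) * (1 + e * t j)\<^sup>2))"
    using eventually_at_right_less[of "0::real"] by eventually_elim simp
  then obtain e :: real where e: "0 < e"
    and sgn': "\<forall>j\<in>{..d}. 0 < (-1) ^ (d + j) * (poly U (t j) - poly W (t j) * (1 + e * t j)\<^sup>2)"
    using eventually_happens'[OF trivial_limit_at_right_real] by blast
  have "W \<noteq> 0" using assms(2) by auto
  then have "degree (W * [:1, e:]\<^sup>2) = degree W + 2"
    using e by (simp add: degree_mult_eq degree_power_eq)
  moreover have "0 < lead_coeff (W * [:1, e:]\<^sup>2)"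
    using e assms(2) unfolding lead_coeff_mult lead_coeff_power by simp
  ultimately obtain T where T: "t d < T" "poly U T < poly (W * [:1, e:]\<^sup>2) T"
    using poly_less_beyond[of U "W * [:1, e:]\<^sup>2" "t d"] assms(3) by auto
  have "alternating (W * [:1, e:]\<^sup>2) U (Suc d)"
    unfolding alternating_def
  \<comment> \<open>The sides are exchanged and the exponent grows by one, so both sign changes
    cancel at the old points; at \<open>T\<close> the larger degree decides.\<close>
  proof (intro exI[of _ "t(Suc d := T)"] conjI allI impI)
    fix j assume "j \<le> Suc d"
    then show "0 < (-1) ^ (Suc d + j) * (poly (W * [:1, e:]\<^sup>2) ((t(Suc d := T)) j) - poly U ((t(Suc d := T)) j))"
      using T sgn'[rule_format, of j] by (cases "j = Suc d") (auto simp: algebra_simps)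
  qed (use t T in \<open>auto simp: less_Suc_eq\<close>)
  with e show ?thesis by blast
qed

text \<open>A factor \<open>(1 + e x)\<^sup>2\<close> with small \<open>e < 0\<close> on the larger side makes that side vanish at the
  far away point \<open>- 1 / e\<close> only, which creates two more sign changes.\<close>

lemma alternating_spike:
  assumes "alternating U W d" "0 < lead_coeff U" "degree W < degree U + 2"
    and pos: "\<And>y. 0 < y \<Longrightarrow> 0 < poly W y"
  shows "\<exists>e<0. alternating (U * [:1, e:]\<^sup>2) W (d + 2)"
proof -
  obtain t where t: "0 < t 0" "\<And>j. j < d \<Longrightarrow> t j < t (Suc j)"
    and sgn: "\<And>j. j \<le> d \<Longrightarrow> 0 < (-1) ^ (d + j) * (poly U (t j) - poly W (t j))"
    using assms(1) unfolding alternating_def by blast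
  have "\<forall>\<^sub>F e in at_left 0. \<forall>j\<in>{..d}. 0 < (-1) ^ (d + j) * (poly U (t j) * (1 + e * t j)\<^sup>2 - poly W (t j))"
  proof (intro eventually_ball_finite ballI)
    fix j assume "j \<in> {..d}"
    have "((\<lambda>e. (-1) ^ (d + j) * (poly U (t j) * (1 + e * t j)\<^sup>2 - poly W (t j))) \<longlongrightarrow>
        (-1) ^ (d + j) * (poly U (t j) * (1 + 0 * t j)\<^sup>2 - poly W (t j))) (at_left 0)"
      by (intro tendsto_intros)
    then show "\<forall>\<^sub>F e in at_left 0. 0 < (-1) ^ (d + j) * (poly U (t j) * (1 + e * t j)\<^sup>2 - poly W (t j))"
      using sgn[of j] \<open>j \<in> {..d}\<close> by (intro order_tendstoD(1)) auto
  qed simp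
  \<comment> \<open>This condition places \<open>- 1 / e\<close> to the right of all old sample
    points.\<close>
  moreover have "\<forall>\<^sub>F e in at_left 0. 0 < 1 + e * t d"
    by (rule order_tendstoD(1)[where y = "1 + 0 * t d"]) (intro tendsto_intros, simp)
  moreover have "\<forall>\<^sub>F e in at_left 0. e < (0::real)"
    by (simp add: eventually_at_filter)
  ultimately have "\<forall>\<^sub>F e in at_left 0. e < 0 \<and> 0 < 1 + e * t d \<and>
      (\<forall>j\<in>{..d}. 0 < (-1) ^ (d + j) * (poly U (t j) * (1 + e * t j)\<^sup>2 - poly W (t j)))"
    by eventually_elim simp
  then obtain e :: real where e: "e < 0" "0 < 1 + e * t d"
    and sgn': "\<forall>j\<in>{..d}. 0 < (-1) ^ (d + j) * (poly U (t j) * (1 + e * t j)\<^sup>2 - poly W (t j))"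
    using eventually_happens'[OF trivial_limit_at_left_real] by blast
  have "U \<noteq> 0" using assms(2) by auto
  then have "degree (U * [:1, e:]\<^sup>2) = degree U + 2"
    using e by (simp add: degree_mult_eq degree_power_eq)
  moreover have "0 < lead_coeff (U * [:1, e:]\<^sup>2)"
    using e assms(2) unfolding lead_coeff_mult lead_coeff_power by simp
  ultimately obtain T where T: "- 1 / e < T" "poly W T < poly (U * [:1, e:]\<^sup>2) T"
    using poly_less_beyond[of W "U * [:1, e:]\<^sup>2" "- 1 / e"] assms(3) by auto
  have td: "t d < - 1 / e" using e by (simp add: field_simps)
  have "alternating (U * [:1, e:]\<^sup>2) W (d + 2)"
    unfolding alternating_def
  proof (intro exI[of _ "t(Suc d := - 1 / e, Suc (Suc d) := T)"] conjI allI impI)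
    fix j assume "j \<le> d + 2"
    then consider "j \<le> d" | "j = Suc d" | "j = Suc (Suc d)" by linarith
    then show "0 < (-1) ^ (d + 2 + j) * (poly (U * [:1, e:]\<^sup>2) ((t(Suc d := - 1 / e, Suc (Suc d) := T)) j) -
        poly W ((t(Suc d := - 1 / e, Suc (Suc d) := T)) j))"
    proof cases
      case 1
      then show ?thesis using sgn'[rule_format, of j] by (auto simp: algebra_simps)
    next
      case 2
      have "0 < poly W (- 1 / e)" using e by (intro pos) (simp add: field_simps)
      then show ?thesis using 2 e by (simp add: power_add)
    next
      case 3
      then show ?thesis using T by (simp add: power_add)
    qed
  qed (use t T td in \<open>auto simp: less_Suc_eq\<close>)
  with e show ?thesis by blast
qed

section \<open>Products of squared linear factors and the choice of the parameters\<close>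

definition sqprod :: "('i \<Rightarrow> 'a::field) \<Rightarrow> 'i set \<Rightarrow> 'a poly" where
  "sqprod b I = (\<Prod>i\<in>I. [:1, b i:]\<^sup>2)"

lemma sqprod_insert:
  assumes "finite I" "i \<notin> I"
  shows "sqprod (b(i := e)) (insert i I) = sqprod b I * [:1, e:]\<^sup>2"
  using assms by (auto simp: sqprod_def mult.commute intro!: arg_cong2[where f = "(*)"] prod.cong)

lemma sqprod_cong:
  "(\<And>i. i \<in> I \<Longrightarrow> b i = b' i) \<Longrightarrow> sqprod b I = sqprod b' I"
  by (simp add: sqprod_def)

lemma poly_sqprod: "poly (sqprod b I) z = (\<Prod>i\<in>I. (1 + b i * z)\<^sup>2)"
  by (simp add: sqprod_def poly_prod mult.commute)

lemma poly_sqprod_pos: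
  fixes b :: "'i \<Rightarrow> real"
  assumes "\<And>i. i \<in> I \<Longrightarrow> 0 < b i" "0 < y"
  shows "0 < poly (sqprod b I) y"
  unfolding poly_sqprod using assms
  by (intro prod_pos zero_less_power add_pos_pos mult_pos_pos) auto

lemma sqprod_ne_0: "sqprod b I \<noteq> 0"
  unfolding sqprod_def by (cases "finite I") auto

lemma degree_sqprod: "(\<And>i. i \<in> I \<Longrightarrow> b i \<noteq> 0) \<Longrightarrow> degree (sqprod b I) = 2 * card I"
  unfolding sqprod_def
  by (induction I rule: infinite_finite_induct) (auto simp: degree_mult_eq degree_power_eq)

lemma lead_coeff_sqprod: 
  fixes b :: "'i \<Rightarrow> real"
  shows "(\<And>i. i \<in> I \<Longrightarrow> b i \<noteq> 0) \<Longrightarrow> 0 < lead_coeff (sqprod b I)"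
  unfolding sqprod_def lead_coeff_prod
  by (rule prod_pos) (auto simp: lead_coeff_power zero_less_power2 power_eq_0_iff)

lemma degree_x_sqprod: "(\<And>i. i \<in> I \<Longrightarrow> b i \<noteq> 0) \<Longrightarrow> degree ([:0, 1:] * sqprod b I) = 2 * card I + 1"
  using sqprod_ne_0[of b I] by (simp add: degree_mult_eq degree_sqprod del: mult_pCons_left)

lemma lead_coeff_x_sqprod: 
  fixes b :: "'i \<Rightarrow> real"
  shows "(\<And>i. i \<in> I \<Longrightarrow> b i \<noteq> 0) \<Longrightarrow> 0 < lead_coeff ([:0, 1:] * sqprod b I)"
  using lead_coeff_sqprod[of I b] by (simp only: lead_coeff_mult) simp

text \<open>Induction on \<open>K\<close>: a new index always joins the side of smaller degree,
  where a small positive parameter adds one root and makes this side the larger one by degree one.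
  The two alternatives therefore take turns.\<close>

lemma exists_alternating_kinks:
  assumes "finite K"
  shows "\<exists>P N (b::'i \<Rightarrow> real). P \<union> N = K \<and> P \<inter> N = {} \<and> (\<forall>i\<in>K. 0 < b i) \<and>
    (card P = card N \<and> alternating ([:0, 1:] * sqprod b N) (sqprod b P) (Suc (card K)) \<or>
     card P = Suc (card N) \<and> alternating (sqprod b P) ([:0, 1:] * sqprod b N) (Suc (card K)))"
  using assms
proof (induction K rule: finite_induct)
  case empty
  \<comment> \<open>The initial equation \<open>y = 1\<close> has its root between the sample points
    1/2 and 2.\<close>
  have "alternating [:0, 1:] 1 1"
    unfolding alternating_def
    by (rule exI[of _ "\<lambda>j. if j = 0 then 1/2 else 2"]) (auto simp: le_Suc_eq)
  then show ?case
    by - (rule exI[of _ "{}"], rule exI[of _ "{}"], simp add: sqprod_def)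
next
  case (insert i K)
  then obtain P N and b :: "'i \<Rightarrow> real" where PN: "P \<union> N = K" "P \<inter> N = {}" "\<And>i. i \<in> K \<Longrightarrow> 0 < b i"
    and alt: "card P = card N \<and> alternating ([:0, 1:] * sqprod b N) (sqprod b P) (Suc (card K)) \<or>
     card P = Suc (card N) \<and> alternating (sqprod b P) ([:0, 1:] * sqprod b N) (Suc (card K))"
    by blast
  have fin: "finite P" "finite N" and iPN: "i \<notin> P" "i \<notin> N"
    using insert.hyps by (auto simp: PN(1)[symmetric])
  have bP: "b j \<noteq> 0" if "j \<in> P" for j using PN(1) PN(3)[of j] that by auto
  have bN: "b j \<noteq> 0" if "j \<in> N" for j using PN(1) PN(3)[of j] that by auto
  have same: "sqprod (b(i := e)) P = sqprod b P" "sqprod (b(i := e)) N = sqprod b N" for e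
    using iPN by (auto intro!: sqprod_cong)
  have deg: "degree (sqprod b P) = 2 * card P" "degree ([:0, 1:] * sqprod b N) = 2 * card N + 1"
    by (rule degree_sqprod, erule bP) (rule degree_x_sqprod, erule bN)
  have lead: "0 < lead_coeff (sqprod b P)" "0 < lead_coeff ([:0, 1:] * sqprod b N)"
    by (rule lead_coeff_sqprod, erule bP) (rule lead_coeff_x_sqprod, erule bN)
  from alt show ?case
  proof (elim disjE conjE)
    assume c: "card P = card N" and a: "alternating ([:0, 1:] * sqprod b N) (sqprod b P) (Suc (card K))"
    have "degree ([:0, 1:] * sqprod b N) < degree (sqprod b P) + 2"
      using c unfolding deg by simp
    from alternating_kink[OF a lead(1) this] obtain e
      where e: "0 < e" "alternating (sqprod b P * [:1, e:]\<^sup>2) ([:0, 1:] * sqprod b N) (Suc (Suc (card K)))"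
      by blast
    have eq: "sqprod (b(i := e)) (insert i P) = sqprod b P * [:1, e:]\<^sup>2"
      using fin iPN by (intro sqprod_insert)
    have alt: "alternating (sqprod (b(i := e)) (insert i P)) ([:0, 1:] * sqprod (b(i := e)) N)
        (Suc (card (insert i K)))"
      using e(2) by (simp only: eq same mult.assoc card_insert_disjoint[OF insert.hyps(1,2)])
    show ?thesis
      by (rule exI[of _ "insert i P"], rule exI[of _ N], rule exI[of _ "b(i := e)"], intro conjI disjI2 alt)
         (use PN fin iPN c e(1) insert.hyps in auto)
  next
    assume c: "card P = Suc (card N)" and a: "alternating (sqprod b P) ([:0, 1:] * sqprod b N) (Suc (card K))"
    have "degree (sqprod b P) < degree ([:0, 1:] * sqprod b N) + 2"
      using c unfolding deg by simp
    from alternating_kink[OF a lead(2) this] obtain e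
      where e: "0 < e" "alternating ([:0, 1:] * sqprod b N * [:1, e:]\<^sup>2) (sqprod b P) (Suc (Suc (card K)))"
      by blast
    have eq: "sqprod (b(i := e)) (insert i N) = sqprod b N * [:1, e:]\<^sup>2"
      using fin iPN by (intro sqprod_insert)
    have alt: "alternating ([:0, 1:] * sqprod (b(i := e)) (insert i N)) (sqprod (b(i := e)) P)
        (Suc (card (insert i K)))"
      using e(2) by (simp only: eq same mult.assoc card_insert_disjoint[OF insert.hyps(1,2)])
    show ?thesis
      by (rule exI[of _ P], rule exI[of _ "insert i N"], rule exI[of _ "b(i := e)"], intro conjI disjI1 alt)
         (use PN fin iPN c e(1) insert.hyps in auto)
  qed
qed

text \<open>Starting from the configuration for \<open>K\<close>, every index of \<open>S\<close>
  joins the side that already has the larger degree. The parameters on the other side stay positive,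
  so that side is positive at positive points, as the spike construction requires.\<close>

lemma exists_alternating:
  assumes "finite S" "finite K" "S \<inter> K = {}"
  shows "\<exists>P N (b::'i \<Rightarrow> real). P \<union> N = S \<union> K \<and> P \<inter> N = {} \<and> (\<forall>i\<in>K. 0 < b i) \<and> (\<forall>i\<in>S. b i < 0) \<and>
    (S \<subseteq> N \<and> 2 * card N + 1 = card K + 2 * card S + 1 \<and> card P \<le> card N \<and>
       alternating ([:0, 1:] * sqprod b N) (sqprod b P) (card K + 2 * card S + 1) \<or>
     S \<subseteq> P \<and> 2 * card P = card K + 2 * card S + 1 \<and> card N < card P \<and>
       alternating (sqprod b P) ([:0, 1:] * sqprod b N) (card K + 2 * card S + 1))"
  using assms(1,3)
proof (induction S rule: finite_induct)
  case empty
  obtain P N and b :: "'i \<Rightarrow> real" where PN: "P \<union> N = K" "P \<inter> N = {}" "\<forall>i\<in>K. 0 < b i"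
    and alt: "card P = card N \<and> alternating ([:0, 1:] * sqprod b N) (sqprod b P) (Suc (card K)) \<or>
     card P = Suc (card N) \<and> alternating (sqprod b P) ([:0, 1:] * sqprod b N) (Suc (card K))"
    using exists_alternating_kinks[OF assms(2)] by blast
  have "card K = card P + card N"
    using PN assms(2) by (metis card_Un_disjoint finite_Un)
  then show ?case
    using PN alt by - (rule exI[of _ P], rule exI[of _ N], rule exI[of _ b], auto)
next
  case (insert i S)
  then obtain P N and b :: "'i \<Rightarrow> real" where PN: "P \<union> N = S \<union> K" "P \<inter> N = {}"
      "\<forall>i\<in>K. 0 < b i" "\<forall>i\<in>S. b i < 0"
    and alt: "S \<subseteq> N \<and> 2 * card N + 1 = card K + 2 * card S + 1 \<and> card P \<le> card N \<and>
       alternating ([:0, 1:] * sqprod b N) (sqprod b P) (card K + 2 * card S + 1) \<or>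
     S \<subseteq> P \<and> 2 * card P = card K + 2 * card S + 1 \<and> card N < card P \<and>
       alternating (sqprod b P) ([:0, 1:] * sqprod b N) (card K + 2 * card S + 1)"
    by blast
  have fin: "finite P" "finite N"
    using PN(1) insert.hyps assms(2) by (metis finite_Un)+
  have iK: "i \<notin> K" using insert.prems by simp
  have iPN: "i \<notin> P" "i \<notin> N"
    using insert.hyps iK PN(1) by blast+
  have b0: "b j \<noteq> 0" if "j \<in> S \<union> K" for j
    using that PN(3)[rule_format, of j] PN(4)[rule_format, of j] by (elim UnE) simp_all
  have bP: "b j \<noteq> 0" if "j \<in> P" for j using b0[of j] that PN(1) by blast
  have bN: "b j \<noteq> 0" if "j \<in> N" for j using b0[of j] that PN(1) by blast
  have same: "sqprod (b(i := e)) P = sqprod b P" "sqprod (b(i := e)) N = sqprod b N" for e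
    using iPN by (auto intro!: sqprod_cong)
  have deg: "degree (sqprod b P) = 2 * card P" "degree ([:0, 1:] * sqprod b N) = 2 * card N + 1"
    by (rule degree_sqprod, erule bP) (rule degree_x_sqprod, erule bN)
  have lead: "0 < lead_coeff (sqprod b P)" "0 < lead_coeff ([:0, 1:] * sqprod b N)"
    by (rule lead_coeff_sqprod, erule bP) (rule lead_coeff_x_sqprod, erule bN)
  from alt show ?case
  proof (elim disjE conjE)
    assume c: "S \<subseteq> N" "2 * card N + 1 = card K + 2 * card S + 1" "card P \<le> card N"
      and a: "alternating ([:0, 1:] * sqprod b N) (sqprod b P) (card K + 2 * card S + 1)"
    have "0 < b j" if "j \<in> P" for j
      using that PN(1,2) c(1) PN(3)[rule_format, of j] by blast
    then have pos: "0 < poly (sqprod b P) y" if "0 < y" for y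
      using that by (rule poly_sqprod_pos)
    have "degree (sqprod b P) < degree ([:0, 1:] * sqprod b N) + 2"
      using c unfolding deg by simp
    from alternating_spike[OF a lead(2) this pos] obtain e
      where e: "e < 0" "alternating ([:0, 1:] * sqprod b N * [:1, e:]\<^sup>2) (sqprod b P) (card K + 2 * card S + 1 + 2)"
      by blast
    have eq: "sqprod (b(i := e)) (insert i N) = sqprod b N * [:1, e:]\<^sup>2"
      using fin iPN by (intro sqprod_insert)
    have alt: "alternating ([:0, 1:] * sqprod (b(i := e)) (insert i N)) (sqprod (b(i := e)) P)
        (card K + 2 * card (insert i S) + 1)"
      using e(2) by (simp only: eq same mult.assoc card_insert_disjoint[OF insert.hyps(1,2)] mult_Suc_right add_ac)
    show ?thesis
      by (rule exI[of _ P], rule exI[of _ "insert i N"], rule exI[of _ "b(i := e)"], intro conjI disjI1 alt,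
          use PN(1) in simp, use PN(2) iPN in simp, use PN(3) iK in auto, use PN(4) e(1) in auto,
          use c(1) in auto, use c(2) fin iPN insert.hyps in simp, use c(3) fin iPN in simp)
  next
    assume c: "S \<subseteq> P" "2 * card P = card K + 2 * card S + 1" "card N < card P"
      and a: "alternating (sqprod b P) ([:0, 1:] * sqprod b N) (card K + 2 * card S + 1)"
    have "0 < b j" if "j \<in> N" for j
      using that PN(1,2) c(1) PN(3)[rule_format, of j] by blast
    then have pos: "0 < poly ([:0, 1:] * sqprod b N) y" if "0 < y" for y
      using that poly_sqprod_pos[of N b y] by simp
    have "degree ([:0, 1:] * sqprod b N) < degree (sqprod b P) + 2"
      using c unfolding deg by simp
    from alternating_spike[OF a lead(1) this pos] obtain e
      where e: "e < 0" "alternating (sqprod b P * [:1, e:]\<^sup>2) ([:0, 1:] * sqprod b N) (card K + 2 * card S + 1 + 2)"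
      by blast
    have eq: "sqprod (b(i := e)) (insert i P) = sqprod b P * [:1, e:]\<^sup>2"
      using fin iPN by (intro sqprod_insert)
    have alt: "alternating (sqprod (b(i := e)) (insert i P)) ([:0, 1:] * sqprod (b(i := e)) N)
        (card K + 2 * card (insert i S) + 1)"
      using e(2) by (simp only: eq same mult.assoc card_insert_disjoint[OF insert.hyps(1,2)] mult_Suc_right add_ac)
    show ?thesis
      by (rule exI[of _ "insert i P"], rule exI[of _ N], rule exI[of _ "b(i := e)"], intro conjI disjI2 alt,
          use PN(1) in simp, use PN(2) iPN in simp, use PN(3) iK in auto, use PN(4) e(1) in auto,
          use c(1) in auto, use c(2) fin iPN insert.hyps in simp, use c(3) fin iPN in simp)
  qed
qed

text \<open>The degrees \<open>2 * card P\<close> and \<open>2 * card N + 1\<close> differ in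
  parity, so the leading terms cannot cancel and the difference has degree \<open>card Y\<close>.
  Hence \<open>Y\<close> exhausts the roots in every \<open>real_field\<close>, the complex numbers
  included.\<close>

lemma roots_eq_real_roots:
  fixes b :: "'i \<Rightarrow> real"
  assumes "\<And>i. i \<in> P \<union> N \<Longrightarrow> b i \<noteq> 0"
    and card: "card Y = max (2 * card P) (2 * card N + 1)"
    and Y: "\<And>y. y \<in> Y \<Longrightarrow> y * (\<Prod>i\<in>N. (1 + b i * y)\<^sup>2) = (\<Prod>i\<in>P. (1 + b i * y)\<^sup>2)"
  shows "{z::'a::real_field. z * (\<Prod>i\<in>N. (1 + of_real (b i) * z)\<^sup>2) = (\<Prod>i\<in>P. (1 + of_real (b i) * z)\<^sup>2)} = of_real ` Y"
    (is "?Z = _")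
proof -
  define b' :: "'i \<Rightarrow> 'a" where "b' i = of_real (b i)" for i
  define U where "U = [:0, 1:] * sqprod b' N"
  define W where "W = sqprod b' P"
  have degU: "degree U = 2 * card N + 1" and degW: "degree W = 2 * card P"
    unfolding U_def W_def using assms(1) by (intro degree_x_sqprod degree_sqprod; simp add: b'_def)+
  have deg: "degree (U - W) = max (2 * card P) (2 * card N + 1)"
  proof (cases "degree W < degree U")
    case True
    then show ?thesis using degree_add_eq_left[of "- W" U] degU degW by simp
  next
    case False
    then have "degree U < degree W" using degU degW by presburger
    then show ?thesis using degree_add_eq_right[of U "- W"] degU degW by simp
  qed
  have "degree U \<noteq> degree W" using degU degW by presburger
  then have "U \<noteq> W" by blast
  moreover have Z: "?Z = {z. poly (U - W) z = 0}"
    by (simp add: U_def W_def poly_sqprod b'_def)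
  ultimately have fin: "finite ?Z" and le: "card ?Z \<le> card Y"
    using poly_roots_finite[of "U - W"] card_poly_roots_bound[of "U - W"] card deg by auto
  have "of_real ` Y \<subseteq> ?Z"
  proof safe
    fix y assume "y \<in> Y"
    from arg_cong[OF Y[OF this], of "of_real :: real \<Rightarrow> 'a"]
    show "of_real y * (\<Prod>i\<in>N. (1 + of_real (b i) * of_real y)\<^sup>2) = (\<Prod>i\<in>P. (1 + of_real (b i) * of_real y :: 'a)\<^sup>2)"
      by simp
  qed
  moreover have "card (of_real ` Y :: 'a set) = card Y"
    by (intro card_image inj_onI) simp
  ultimately have "of_real ` Y = ?Z"
    using le by (intro card_seteq[OF fin]) simp_all
  then show ?thesis by (rule sym)
qed

subsection \<open>Volume of the convex hull\<close>

lemma std_simplex_cart: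
  "convex hull (insert 0 Basis) = {x::real^'n. (\<forall>i. 0 \<le> x $ i) \<and> (\<Sum>i\<in>UNIV. x $ i) \<le> 1}"
proof -
  have B: "(Basis :: (real^'n) set) = range (\<lambda>i. axis i 1)"
    by (auto simp: Basis_vec_def)
  have "(\<Sum>b\<in>Basis. x \<bullet> b) = (\<Sum>i\<in>UNIV. x $ i)" for x :: "real^'n"
    unfolding B by (subst sum.reindex) (auto simp: inj_on_def axis_eq_axis inner_axis)
  then show ?thesis
    unfolding std_simplex by (auto simp: B inner_axis)
qed

text \<open>The weights that the vertex \<open>u\<close> can carry when \<open>x\<close> is written as a convex
  combination of \<open>u\<close>, the origin and the standard basis vectors.\<close>

definition apex_weights :: "real^'n \<Rightarrow> real^'n \<Rightarrow> real set" where
  "apex_weights u x = {\<beta>. 0 \<le> \<beta> \<and> (\<forall>i. 0 \<le> x $ i - \<beta> * u $ i) \<and> (\<Sum>i\<in>UNIV. x $ i - \<beta> * u $ i) + \<beta> \<le> 1}"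

text \<open>In this form the last condition is affine in the weight, and the sign of
  \<open>1 - (\<Sum>i\<in>UNIV. u $ i)\<close> tells whether raising or lowering the weight relaxes
  it.\<close>

lemma apex_weights_alt:
  "\<beta> \<in> apex_weights u x \<longleftrightarrow> 0 \<le> \<beta> \<and> (\<forall>i. \<beta> * u $ i \<le> x $ i) \<and>
     (\<Sum>i\<in>UNIV. x $ i) + \<beta> * (1 - (\<Sum>i\<in>UNIV. u $ i)) \<le> 1"
  by (simp add: apex_weights_def sum_subtractf sum_distrib_left algebra_simps)

lemma hull_apex_eq:
  "convex hull (insert u (insert 0 Basis)) = {x::real^'n. apex_weights u x \<noteq> {}}"
proof -
  have "x \<in> convex hull (insert u (insert 0 Basis)) \<longleftrightarrow> apex_weights u x \<noteq> {}" for x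
  proof
    assume "x \<in> convex hull (insert u (insert 0 Basis))"
    then obtain v w q where *: "0 \<le> v" "0 \<le> w" "v + w = 1" "q \<in> convex hull (insert 0 Basis)"
      "x = v *\<^sub>R u + w *\<^sub>R q"
      by (subst (asm) convex_hull_insert) auto
    have q: "\<And>i. 0 \<le> q $ i" "(\<Sum>i\<in>UNIV. q $ i) \<le> 1"
      using *(4) by (auto simp: std_simplex_cart)
    have "(\<Sum>i\<in>UNIV. x $ i - v * u $ i) = w * (\<Sum>i\<in>UNIV. q $ i)"
      by (simp add: *(5) sum_distrib_left)
    also have "\<dots> \<le> w" using q *(2) by (simp add: mult_left_le)
    finally have "v \<in> apex_weights u x"
      using * q by (simp add: apex_weights_def)
    then show "apex_weights u x \<noteq> {}" by blast
  next
    assume "apex_weights u x \<noteq> {}"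
    then obtain v where v: "0 \<le> v" "\<And>i. 0 \<le> x $ i - v * u $ i"
      "(\<Sum>i\<in>UNIV. x $ i - v * u $ i) + v \<le> 1"
      by (auto simp: apex_weights_def)
    have s: "0 \<le> (\<Sum>i\<in>UNIV. x $ i - v * u $ i)" using v by (intro sum_nonneg) auto
    \<comment> \<open>For \<open>v = 1\<close> division by zero makes \<open>q\<close> the origin,
      which is consistent because the remainder \<open>x - v *\<^sub>R u\<close> then
      vanishes.\<close>
    define q where "q = (1 / (1 - v)) *\<^sub>R (x - v *\<^sub>R u)"
    have "x = v *\<^sub>R u + (1 - v) *\<^sub>R q"
    proof (cases "v = 1")
      case True
      then have "(\<Sum>i\<in>UNIV. x $ i - v * u $ i) = 0" using v s by simp
      then have "\<forall>i\<in>UNIV. x $ i - v * u $ i = 0"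
        by (subst sum_nonneg_eq_0_iff[symmetric]) (use v in auto)
      then show ?thesis using True by (simp add: vec_eq_iff)
    qed (simp add: q_def)
    moreover have "(\<Sum>i\<in>UNIV. q $ i) = (1 / (1 - v)) * (\<Sum>i\<in>UNIV. x $ i - v * u $ i)"
      unfolding q_def by (simp add: sum_distrib_left sum_divide_distrib)
    then have "q \<in> convex hull (insert 0 Basis)"
      using v s by (auto simp: std_simplex_cart q_def divide_le_eq zero_le_divide_iff)
    ultimately show "x \<in> convex hull (insert u (insert 0 Basis))"
      using v s by (subst convex_hull_insert)
        (simp, intro CollectI exI[of _ v] exI[of _ "1 - v"] exI[of _ q] conjI, auto)
  qed
  then show ?thesis by blast
qed

text \<open>For \<open>u $ k \<noteq> 0\<close> these are the points of the simplex spanned by \<open>u\<close>, the origin and all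
  basis vectors except the \<open>k\<close>-th one.\<close>

definition apex_piece :: "real^'n \<Rightarrow> 'n \<Rightarrow> (real^'n) set" where
  "apex_piece u k = {x. x $ k / u $ k \<in> apex_weights u x}"

text \<open>This is the linear map that sends the \<open>k\<close>-th basis vector to
  \<open>u\<close> and fixes the other basis vectors.\<close>

definition replace_axis :: "real^'n \<Rightarrow> 'n \<Rightarrow> real^'n \<Rightarrow> real^'n" where
  "replace_axis u k x = (\<chi> i. (if i = k then 0 else x $ i) + x $ k * u $ i)"

lemma linear_replace_axis: "linear (replace_axis u k)"
  by (rule linearI) (auto simp: replace_axis_def vec_eq_iff algebra_simps)

text \<open>The matrix is the identity with column \<open>k\<close> replaced by \<open>u\<close>,
  the situation of Cramer's rule.\<close>

lemma det_replace_axis: "det (matrix (replace_axis u k)) = u $ k"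
proof -
  have "matrix (replace_axis u k) = (\<chi> i j. if j = k then (mat 1 *v u) $ i else mat 1 $ i $ j)"
    unfolding matrix_vector_mul_lid
    by (auto simp: matrix_def replace_axis_def vec_eq_iff axis_def mat_def)
  then show ?thesis using cramer_lemma[of k "mat 1" u] by simp
qed

lemma apex_piece_eq_image:
  assumes "u $ k \<noteq> 0"
  shows "apex_piece u k = replace_axis u k ` (convex hull (insert 0 Basis))"
proof (intro equalityI subsetI)
  fix x assume "x \<in> apex_piece u k"
  then have x: "0 \<le> x $ k / u $ k" "\<And>i. 0 \<le> x $ i - x $ k / u $ k * u $ i"
      "(\<Sum>i\<in>UNIV. x $ i - x $ k / u $ k * u $ i) + x $ k / u $ k \<le> 1"
    by (auto simp: apex_piece_def apex_weights_def)
  \<comment> \<open>When \<open>u\<close> carries the weight \<open>x $ k / u $ k\<close>, the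
    \<open>k\<close>-th coordinate of the remainder is zero, so slot \<open>k\<close> is free to
    hold that weight.\<close>
  define a where "a = (\<chi> i. x $ i - x $ k / u $ k * u $ i + (if i = k then x $ k / u $ k else 0))"
  have "(\<Sum>i\<in>UNIV. a $ i) = (\<Sum>i\<in>UNIV. x $ i - x $ k / u $ k * u $ i) + x $ k / u $ k"
    by (simp add: a_def sum.distrib)
  then have "a \<in> convex hull (insert 0 Basis)"
    using x by (auto simp: std_simplex_cart a_def)
  moreover have "x = replace_axis u k a"
    using assms by (auto simp: a_def replace_axis_def vec_eq_iff)
  ultimately show "x \<in> replace_axis u k ` (convex hull (insert 0 Basis))" by blast
next
  fix x assume "x \<in> replace_axis u k ` (convex hull (insert 0 Basis))"
  then obtain a where a: "x = replace_axis u k a" "\<And>i. 0 \<le> a $ i" "(\<Sum>i\<in>UNIV. a $ i) \<le> 1"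
    by (auto simp: std_simplex_cart)
  have ak: "x $ k / u $ k = a $ k" using assms by (simp add: a(1) replace_axis_def)
  have d: "x $ i - a $ k * u $ i = (if i = k then 0 else a $ i)" for i
    by (simp add: a(1) replace_axis_def)
  have "(\<Sum>i\<in>UNIV. x $ i - a $ k * u $ i) = (\<Sum>i\<in>UNIV - {k}. a $ i)"
    unfolding d by (intro sum.mono_neutral_cong_right) auto
  then have "(\<Sum>i\<in>UNIV. x $ i - a $ k * u $ i) + a $ k = (\<Sum>i\<in>UNIV. a $ i)"
    by (simp add: sum.remove[of UNIV k])
  moreover have "0 \<le> x $ i - a $ k * u $ i" for i by (simp add: d a(2))
  ultimately show "x \<in> apex_piece u k"
    using a(2,3) by (simp only: apex_piece_def apex_weights_def mem_Collect_eq ak) simp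
qed

lemma lmeasurable_std_simplex: "convex hull (insert 0 Basis :: (real^'n) set) \<in> lmeasurable"
  by (intro lmeasurable_compact compact_convex_hull finite_imp_compact) simp

lemma measure_std_simplex:
  "measure lebesgue (convex hull (insert 0 Basis :: (real^'n) set)) = 1 / fact CARD('n)"
proof -
  have "compact (convex hull (insert 0 Basis :: (real^'n) set))"
    by (intro compact_convex_hull finite_imp_compact) simp
  then have "measure lebesgue (convex hull (insert 0 Basis :: (real^'n) set)) =
      measure lborel (convex hull (insert 0 Basis :: (real^'n) set))"
    by (intro measure_completion) (simp add: borel_compact)
  then show ?thesis using content_std_simplex[where 'a = "real^'n"] by simp
qed

lemma measure_apex_piece:
  fixes u :: "real^'n::{finite,wellorder}"
  assumes "u $ k \<noteq> 0"
  shows "apex_piece u k \<in> lmeasurable"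
    and "measure lebesgue (apex_piece u k) = \<bar>u $ k\<bar> / fact CARD('n)"
  unfolding apex_piece_eq_image[OF assms]
    measure_linear_image[OF linear_replace_axis lmeasurable_std_simplex]
  by (simp_all add: measurable_linear_image[OF linear_replace_axis lmeasurable_std_simplex]
      det_replace_axis measure_std_simplex)

text \<open>For entries of equal sign the two memberships bound each of the ratios
  \<open>x $ i / u $ i\<close> and \<open>x $ j / u $ j\<close> by the other. The ratios agree, so
  the intersection lies in a hyperplane.\<close>

lemma negligible_apex_pieces:
  fixes u :: "real^'n"
  assumes "i \<noteq> j" "0 < u $ i * u $ j"
  shows "negligible (apex_piece u i \<inter> apex_piece u j)"
proof (rule negligible_subset)
  define a where "a = axis i (u $ j) - axis j (u $ i)"
  have "a $ i \<noteq> 0" using assms by (auto simp: a_def axis_def)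
  then have "a \<noteq> 0" by auto
  then show "negligible {x. a \<bullet> x = 0}" by (intro negligible_hyperplane) simp
  show "apex_piece u i \<inter> apex_piece u j \<subseteq> {x. a \<bullet> x = 0}"
  proof
    fix x assume "x \<in> apex_piece u i \<inter> apex_piece u j"
    then have "x $ i / u $ i * u $ j \<le> x $ j" "x $ j / u $ j * u $ i \<le> x $ i"
      by (auto simp: apex_piece_def apex_weights_alt)
    then have "x $ i * u $ j = x $ j * u $ i"
      using assms(2) by (auto simp: zero_less_mult_iff field_simps)
    then show "x \<in> {x. a \<bullet> x = 0}"
      by (simp add: a_def inner_diff_left inner_axis' algebra_simps)
  qed
qed

text \<open>The simplex forces \<open>x $ j\<close> to be nonnegative and the piece forces it to be
  nonpositive.\<close>

lemma negligible_apex_piece_std_simplex: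
  fixes u :: "real^'n"
  assumes "u $ j < 0"
  shows "negligible (convex hull (insert 0 Basis) \<inter> apex_piece u j)"
proof (rule negligible_subset)
  show "negligible {x::real^'n. axis j 1 \<bullet> x = 0}" by (intro negligible_hyperplane) (simp add: axis_eq_0_iff)
  show "convex hull (insert 0 Basis) \<inter> apex_piece u j \<subseteq> {x. axis j 1 \<bullet> x = 0}"
  proof
    fix x assume "x \<in> convex hull (insert 0 Basis) \<inter> apex_piece u j"
    then have "0 \<le> x $ j" "0 \<le> x $ j / u $ j"
      by (auto simp: std_simplex_cart apex_piece_def apex_weights_alt)
    then show "x \<in> {x. axis j 1 \<bullet> x = 0}"
      using assms by (auto simp: zero_le_divide_iff inner_axis')
  qed
qed

text \<open>Here a larger weight relaxes the last condition. The weight is raised until the first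
  constraint with \<open>0 < u $ k\<close> becomes tight, which happens at the least ratio
  \<open>x $ k / u $ k\<close>.\<close>

lemma hull_apex_cover_pos:
  fixes u :: "real^'n"
  assumes "1 < (\<Sum>i\<in>UNIV. u $ i)"
  shows "convex hull (insert u (insert 0 Basis)) = (\<Union>k\<in>{k. 0 < u $ k}. apex_piece u k)"
proof (intro equalityI subsetI)
  fix x assume "x \<in> convex hull (insert u (insert 0 Basis))"
  then obtain \<beta> where \<beta>: "0 \<le> \<beta>" "\<And>i. \<beta> * u $ i \<le> x $ i"
      "(\<Sum>i\<in>UNIV. x $ i) + \<beta> * (1 - (\<Sum>i\<in>UNIV. u $ i)) \<le> 1"
    unfolding hull_apex_eq ex_in_conv[symmetric] apex_weights_alt by blast
  have "\<not> (\<forall>k. u $ k \<le> 0)"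
    using assms sum_nonpos[of UNIV "\<lambda>i. u $ i"] by auto
  then have "{k. 0 < u $ k} \<noteq> {}" by (auto simp: not_le)
  then obtain k where k: "0 < u $ k" and least: "\<And>i. 0 < u $ i \<Longrightarrow> x $ k / u $ k \<le> x $ i / u $ i"
    using ex_is_arg_min_if_finite[of "{k. 0 < u $ k}" "\<lambda>k. x $ k / u $ k"]
    by (auto simp: is_arg_min_linorder)
  define \<gamma> where "\<gamma> = x $ k / u $ k"
  have ge: "\<beta> \<le> \<gamma>" using \<beta>(2)[of k] k by (simp add: \<gamma>_def field_simps)
  have "\<gamma> * u $ i \<le> x $ i" for i
  proof (cases "0 < u $ i")
    case True
    then show ?thesis using least[OF True] by (simp add: \<gamma>_def[symmetric] field_simps)
  next
    case False
    then have "\<gamma> * u $ i \<le> \<beta> * u $ i" using ge by (intro mult_right_mono_neg) auto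
    then show ?thesis using \<beta>(2)[of i] by linarith
  qed
  moreover have "\<gamma> * (1 - (\<Sum>i\<in>UNIV. u $ i)) \<le> \<beta> * (1 - (\<Sum>i\<in>UNIV. u $ i))"
    using ge assms by (intro mult_right_mono_neg) auto
  ultimately have "\<gamma> \<in> apex_weights u x"
    using \<beta> ge by (auto simp: apex_weights_alt)
  then show "x \<in> (\<Union>k\<in>{k. 0 < u $ k}. apex_piece u k)"
    using k by (auto simp: apex_piece_def \<gamma>_def)
qed (auto simp: hull_apex_eq apex_piece_def)

text \<open>Here a smaller weight does no harm to the last condition. The weight is lowered to 0,
  which leaves a point of the standard simplex, or until the first constraint with
  \<open>u $ k < 0\<close> becomes tight.\<close>

lemma hull_apex_cover_neg:
  fixes u :: "real^'n"
  assumes "(\<Sum>i\<in>UNIV. u $ i) \<le> 1"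
  shows "convex hull (insert u (insert 0 Basis)) =
    convex hull (insert 0 Basis) \<union> (\<Union>k\<in>{k. u $ k < 0}. apex_piece u k)"
proof (intro equalityI subsetI)
  fix x assume "x \<in> convex hull (insert u (insert 0 Basis))"
  then obtain \<beta> where \<beta>: "0 \<le> \<beta>" "\<And>i. \<beta> * u $ i \<le> x $ i"
      "(\<Sum>i\<in>UNIV. x $ i) + \<beta> * (1 - (\<Sum>i\<in>UNIV. u $ i)) \<le> 1"
    unfolding hull_apex_eq ex_in_conv[symmetric] apex_weights_alt by blast
  have weights: "\<gamma> \<in> apex_weights u x"
    if "0 \<le> \<gamma>" "\<gamma> \<le> \<beta>" and neg: "\<And>i. u $ i < 0 \<Longrightarrow> x $ i / u $ i \<le> \<gamma>" for \<gamma>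
  proof -
    have "\<gamma> * u $ i \<le> x $ i" for i
    proof (cases "u $ i < 0")
      case True
      then show ?thesis using neg[OF True] by (simp add: field_simps)
    next
      case False
      then have "\<gamma> * u $ i \<le> \<beta> * u $ i" using that by (intro mult_right_mono) auto
      then show ?thesis using \<beta>(2)[of i] by linarith
    qed
    moreover have "\<gamma> * (1 - (\<Sum>i\<in>UNIV. u $ i)) \<le> \<beta> * (1 - (\<Sum>i\<in>UNIV. u $ i))"
      using that assms by (intro mult_right_mono) auto
    ultimately show ?thesis using \<beta> that by (auto simp: apex_weights_alt)
  qed
  show "x \<in> convex hull (insert 0 Basis) \<union> (\<Union>k\<in>{k. u $ k < 0}. apex_piece u k)"
  proof (cases "\<forall>i. u $ i < 0 \<longrightarrow> x $ i / u $ i \<le> 0")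
    case True
    then have "0 \<in> apex_weights u x" using weights[of 0] \<beta>(1) by blast
    then show ?thesis by (simp add: apex_weights_alt std_simplex_cart)
  next
    case False
    then obtain i where i: "u $ i < 0" "0 < x $ i / u $ i" by (auto simp: not_le)
    then have "{k. u $ k < 0} \<noteq> {}" by blast
    then obtain k where k: "u $ k < 0" and greatest: "\<And>i. u $ i < 0 \<Longrightarrow> x $ i / u $ i \<le> x $ k / u $ k"
      using ex_is_arg_min_if_finite[of "{k. u $ k < 0}" "\<lambda>k. - (x $ k / u $ k)"]
      by (auto simp: is_arg_min_linorder)
    have "x $ k / u $ k \<le> \<beta>" using \<beta>(2)[of k] k by (simp add: field_simps)
    moreover have "0 \<le> x $ k / u $ k" using greatest[OF i(1)] i(2) by linarith
    ultimately have "x $ k / u $ k \<in> apex_weights u x"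
      by (intro weights greatest)
    then show ?thesis using k by (auto simp: apex_piece_def)
  qed
next
  fix x assume "x \<in> convex hull (insert 0 Basis) \<union> (\<Union>k\<in>{k. u $ k < 0}. apex_piece u k)"
  then have "0 \<in> apex_weights u x \<or> (\<exists>k. x $ k / u $ k \<in> apex_weights u x)"
    by (auto simp: std_simplex_cart apex_piece_def apex_weights_alt[of 0])
  then show "x \<in> convex hull (insert u (insert 0 Basis))"
    by (auto simp: hull_apex_eq)
qed

text \<open>The members of each cover overlap in null sets, so their volumes add up. Comparing the
  sum of the entries with 1 is the same as comparing the two arguments of
  \<open>max\<close>.\<close>

lemma measure_hull_apex:
  fixes u :: "real^'n::{finite,wellorder}"
  shows "measure lebesgue (convex hull (insert u (insert 0 Basis))) =
    max (\<Sum>i | 0 < u $ i. u $ i) (1 + (\<Sum>i | u $ i < 0. - u $ i)) / fact CARD('n)"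
proof -
  let ?S = "convex hull (insert 0 Basis) :: (real^'n::{finite,wellorder}) set"
  have split: "(\<Sum>i\<in>UNIV. u $ i) = (\<Sum>i | 0 < u $ i. u $ i) - (\<Sum>i | u $ i < 0. - u $ i)"
  proof -
    have "(\<Sum>i\<in>UNIV. u $ i) = (\<Sum>i\<in>UNIV. (if 0 < u $ i then u $ i else 0) - (if u $ i < 0 then - u $ i else 0))"
      by (intro sum.cong) auto
    then show ?thesis
      by (simp add: sum_subtractf sum.If_cases)
  qed
  show ?thesis
  proof (cases "1 < (\<Sum>i\<in>UNIV. u $ i)")
    case True
    have "measure lebesgue (\<Union>(apex_piece u ` {k. 0 < u $ k})) = (\<Sum>k | 0 < u $ k. measure lebesgue (apex_piece u k))"
      by (rule measure_negligible_finite_Union_image)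
        (auto simp: measure_apex_piece pairwise_def intro!: negligible_apex_pieces)
    also have "\<dots> = (\<Sum>k | 0 < u $ k. u $ k) / fact CARD('n)"
      by (simp add: measure_apex_piece sum_divide_distrib)
    finally show ?thesis using True split by (simp add: hull_apex_cover_pos)
  next
    case False
    \<comment> \<open>\<open>None\<close> indexes the standard simplex and \<open>Some k\<close> the
      pieces, which makes the cover one indexed family.\<close>
    let ?G = "case_option ?S (apex_piece u)"
    let ?J = "insert None (Some ` {k. u $ k < 0})"
    have "convex hull (insert u (insert 0 Basis)) = \<Union>(?G ` ?J)"
      using False by (subst hull_apex_cover_neg) auto
    also have "measure lebesgue \<dots> = (\<Sum>k\<in>?J. measure lebesgue (?G k))"
      by (rule measure_negligible_finite_Union_image)
        (auto simp: measure_apex_piece pairwise_def lmeasurable_std_simplex Int_commute[of _ ?S]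
          intro!: negligible_apex_pieces negligible_apex_piece_std_simplex mult_neg_neg)
    also have "\<dots> = 1 / fact CARD('n) + (\<Sum>k | u $ k < 0. - u $ k / fact CARD('n))"
      by (subst sum.insert) (auto simp: sum.reindex measure_apex_piece measure_std_simplex intro!: sum.cong)
    also have "\<dots> = (1 + (\<Sum>k | u $ k < 0. - u $ k)) / fact CARD('n)"
      by (simp add: add_divide_distrib sum_divide_distrib)
    finally show ?thesis using False split by simp
  qed
qed


section \<open>Stretched simplices and arbitrary finite index types\<close>

lemma linear_stretch: "linear (\<lambda>x::real^'n. \<chi> i. d $ i * x $ i)"
  by (rule linearI) (auto simp: vec_eq_iff algebra_simps)

lemma measure_hull_stretched_apex_wellorder:
  fixes u d :: "real^'n::{finite,wellorder}"
  assumes "\<And>i. 0 < d $ i"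
  shows "measure lborel (convex hull (insert (\<chi> i. d $ i * u $ i) (insert 0 (range (\<lambda>i. axis i (d $ i)))))) =
    (\<Prod>i\<in>UNIV. d $ i) * max (\<Sum>i | 0 < u $ i. u $ i) (1 + (\<Sum>i | u $ i < 0. - u $ i)) / fact CARD('n)"
proof -
  define D where "D = (\<lambda>x::real^'n::{finite,wellorder}. \<chi> i. d $ i * x $ i)"
  have lin: "linear D" unfolding D_def by (rule linear_stretch)
  have det: "det (matrix D) = (\<Prod>i\<in>UNIV. d $ i)"
    by (subst det_diagonal) (auto simp: matrix_def D_def axis_def)
  have B: "(Basis :: (real^'n::{finite,wellorder}) set) = range (\<lambda>i. axis i 1)"
    by (auto simp: Basis_vec_def)
  have "D (axis i 1) = axis i (d $ i)" for i
    by (simp add: D_def vec_eq_iff axis_def)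
  then have "D ` Basis = range (\<lambda>i. axis i (d $ i))"
    unfolding B image_image by simp
  then have "D ` insert u (insert 0 Basis) = insert (\<chi> i. d $ i * u $ i) (insert 0 (range (\<lambda>i. axis i (d $ i))))"
    using linear_0[OF lin] by (simp add: D_def)
  then have hull: "convex hull (insert (\<chi> i. d $ i * u $ i) (insert 0 (range (\<lambda>i. axis i (d $ i))))) =
      D ` (convex hull (insert u (insert 0 Basis)))"
    by (simp only: convex_hull_linear_image[OF lin])
  have comp: "compact (convex hull (insert u (insert 0 Basis)))"
    by (intro compact_convex_hull finite_imp_compact) simp
  have "compact (D ` (convex hull (insert u (insert 0 Basis))))"
    by (intro compact_continuous_image comp linear_continuous_on linear_conv_bounded_linear[THEN iffD1] lin)
  then have "measure lborel (D ` (convex hull (insert u (insert 0 Basis)))) =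
      measure lebesgue (D ` (convex hull (insert u (insert 0 Basis))))"
    by (intro measure_completion[symmetric]) (simp add: borel_compact)
  also have "\<dots> = \<bar>\<Prod>i\<in>UNIV. d $ i\<bar> * measure lebesgue (convex hull (insert u (insert 0 Basis)))"
    unfolding det[symmetric] by (intro measure_linear_image lin lmeasurable_compact comp)
  also have "\<bar>\<Prod>i\<in>UNIV. d $ i\<bar> = (\<Prod>i\<in>UNIV. d $ i)"
    using assms by (intro abs_of_nonneg prod_nonneg) (simp add: less_imp_le)
  finally show ?thesis unfolding hull measure_hull_apex by simp
qed

text \<open>The library only has the change of variables formula for index types of class
  \<open>wellorder\<close>; this copy of a finite type is used to transfer the volume to arbitrary ones.\<close>

typedef 'n ranked = "{..<CARD('n::finite)}" morphisms rank_of Ranked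
  by (intro exI[of _ 0]) simp

instantiation ranked :: (finite) linorder
begin

definition "x \<le> y \<longleftrightarrow> rank_of x \<le> rank_of y" for x y :: "'a ranked"
definition "x < y \<longleftrightarrow> rank_of x < rank_of y" for x y :: "'a ranked"

instance
proof
  fix x y z :: "'a ranked"
  show "x < y \<longleftrightarrow> x \<le> y \<and> \<not> y \<le> x"
    unfolding less_eq_ranked_def less_ranked_def by (rule less_le_not_le)
  show "x \<le> x" unfolding less_eq_ranked_def by (rule order_refl)
  show "x \<le> z" if "x \<le> y" "y \<le> z"
    using that unfolding less_eq_ranked_def by (rule order_trans)
  show "x = y" if "x \<le> y" "y \<le> x"
    using that unfolding less_eq_ranked_def by (intro rank_of_inject[THEN iffD1] order_antisym)
  show "x \<le> y \<or> y \<le> x"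
    unfolding less_eq_ranked_def by (rule linear)
qed

end

instance ranked :: (finite) wellorder
proof
  fix P :: "'a ranked \<Rightarrow> bool" and a
  assume step: "\<And>x. (\<And>y. y < x \<Longrightarrow> P y) \<Longrightarrow> P x"
  show "P a"
  proof (induction a rule: measure_induct_rule[where f = rank_of])
    case (less a)
    show ?case
      by (rule step, rule less.IH) (simp only: less_ranked_def)
  qed
qed

instance ranked :: (finite) finite
proof
  show "finite (UNIV :: 'a ranked set)"
    unfolding type_definition.univ[OF type_definition_ranked] by simp
qed

lemma card_ranked: "CARD('n::finite ranked) = CARD('n)"
  unfolding type_definition.card[OF type_definition_ranked] by simp

text \<open>Relabelling the coordinates takes open boxes to open boxes with the same side lengths,
  and Lebesgue measure is determined by its values on boxes.\<close>

lemma lborel_reindex: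
  fixes h :: "'m::finite \<Rightarrow> 'n::finite"
  assumes "bij h"
  shows "(lborel :: (real^'m) measure) = distr lborel borel (\<lambda>x::real^'n. \<chi> j. x $ h j)"
proof (rule lborel_eqI)
  let ?f = "\<lambda>x::real^'n. (\<chi> j. x $ h j) :: real^'m"
  have meas: "?f \<in> borel_measurable lborel"
    by (simp, intro borel_measurable_continuous_onI continuous_on_vec_lambda continuous_intros)
  fix l r :: "real^'m"
  assume le: "\<And>b. b \<in> Basis \<Longrightarrow> l \<bullet> b \<le> r \<bullet> b"
  let ?g = "\<lambda>x::real^'m. (\<chi> i. x $ inv h i) :: real^'n"
  have hinv: "h (inv h i) = i" "inv h (h j) = j" for i j
    using assms by (simp_all add: bij_is_surj surj_f_inv_f bij_is_inj)
  have "?f -` box l r = box (?g l) (?g r)"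
    unfolding set_eq_iff by (auto simp: mem_box_cart) (metis hinv)+
  have lei: "l $ j \<le> r $ j" for j
    using le[of "axis j 1"] by (simp add: inner_axis)
  have "emeasure (distr lborel borel ?f) (box l r) = emeasure lborel (box (?g l) (?g r))"
    using \<open>?f -` box l r = _\<close> meas by (subst emeasure_distr) auto
  also have "\<dots> = ennreal (\<Prod>i\<in>UNIV. r $ inv h i - l $ inv h i)"
  proof -
    have "(\<Prod>b\<in>Basis. (?g r - ?g l) \<bullet> b) = (\<Prod>i\<in>UNIV. (?g r - ?g l) \<bullet> axis i 1)"
      by (rule prod.reindex_cong[of "\<lambda>i. axis i 1"]) (auto simp: inj_on_def axis_eq_axis Basis_vec_def)
    then show ?thesis
      using lei by (subst emeasure_lborel_box) (auto simp: Basis_vec_def inner_axis)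
  qed
  also have "(\<Prod>i\<in>UNIV. r $ inv h i - l $ inv h i) = (\<Prod>j\<in>UNIV. r $ j - l $ j)"
    using assms by (intro prod.reindex_bij_betw[of "inv h" UNIV UNIV "\<lambda>j. r $ j - l $ j"]) (simp add: bij_imp_bij_inv)
  also have "\<dots> = (\<Prod>b\<in>Basis. (r - l) \<bullet> b)"
    by (rule sym, rule prod.reindex_cong[of "\<lambda>i. axis i 1"]) (auto simp: inj_on_def axis_eq_axis Basis_vec_def inner_axis)
  finally show "emeasure (distr lborel borel ?f) (box l r) = (\<Prod>b\<in>Basis. (r - l) \<bullet> b)" .
qed simp

lemma measure_hull_stretched_apex:
  fixes u d :: "real^'n"
  assumes "\<And>i. 0 < d $ i"
  shows "measure lborel (convex hull (insert (\<chi> i. d $ i * u $ i) (insert 0 (range (\<lambda>i. axis i (d $ i)))))) =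
    (\<Prod>i\<in>UNIV. d $ i) * max (\<Sum>i | 0 < u $ i. u $ i) (1 + (\<Sum>i | u $ i < 0. - u $ i)) / fact CARD('n)"
proof -
  obtain h :: "'n ranked \<Rightarrow> 'n" where h: "bij h"
    using finite_same_card_bij[of "UNIV :: 'n ranked set" "UNIV :: 'n set"] by (auto simp: card_ranked)
  have bij_sub: "bij_betw h {j. P (h j)} {i. P i}" for P
    using h surj_image_vimage_eq[of h "Collect P"]
    by (auto simp: bij_betw_def bij_def vimage_def intro: inj_on_subset)
  define f where "f x = (\<chi> j. x $ h j)" for x :: "real^'n"
  have lin: "linear f" by (rule linearI) (auto simp: f_def vec_eq_iff)
  have "inj f"
    using h by (auto simp: inj_on_def f_def vec_eq_iff) (metis bij_pointE)
  let ?X = "insert (\<chi> i. d $ i * u $ i) (insert 0 (range (\<lambda>i. axis i (d $ i))))"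
  let ?Y = "insert (\<chi> i. f d $ i * f u $ i) (insert 0 (range (\<lambda>i. axis i (f d $ i))))"
  have "f (axis (h j) a) = axis j a" for j a
    using h by (auto simp: f_def vec_eq_iff axis_def bij_def inj_eq)
  moreover have "range (\<lambda>i. axis i (d $ i)) = range (\<lambda>j. axis (h j) (d $ h j))"
    using bij_is_surj[OF h] by (auto simp: image_iff) (metis surjD)
  ultimately have "f ` range (\<lambda>i. axis i (d $ i)) = range (\<lambda>j. axis j (f d $ j))"
    by (simp add: image_image f_def)
  then have "f ` ?X = ?Y" by (auto simp: f_def vec_eq_iff)
  then have "f ` (convex hull ?X) = convex hull ?Y"
    by (simp only: convex_hull_linear_image[OF lin])
  then have vim: "f -` (convex hull ?Y) = convex hull ?X"
    using inj_vimage_image_eq[OF \<open>inj f\<close>] by metis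
  have "compact (convex hull ?Y)"
    by (intro compact_convex_hull finite_imp_compact) simp
  then have "convex hull ?Y \<in> sets borel" by (rule borel_compact)
  moreover have "f \<in> borel_measurable borel"
    by (intro borel_measurable_continuous_onI linear_continuous_on linear_conv_bounded_linear[THEN iffD1] lin)
  ultimately have "measure lborel (convex hull ?Y) = measure lborel (convex hull ?X)"
    unfolding lborel_reindex[OF h] f_def[symmetric] by (subst measure_distr) (simp_all add: vim)
  moreover have "(\<Prod>j\<in>UNIV. f d $ j) = (\<Prod>i\<in>UNIV. d $ i)"
    using h by (simp add: f_def prod.reindex_bij_betw[of h UNIV UNIV "\<lambda>i. d $ i"])
  moreover have "(\<Sum>j | 0 < f u $ j. f u $ j) = (\<Sum>i | 0 < u $ i. u $ i)"
    "(\<Sum>j | f u $ j < 0. - f u $ j) = (\<Sum>i | u $ i < 0. - u $ i)"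
    unfolding f_def vec_lambda_beta by (intro sum.reindex_bij_betw bij_sub)+
  ultimately show ?thesis
    using measure_hull_stretched_apex_wellorder[of "f d" "f u"] assms by (simp add: f_def card_ranked)
qed

subsection \<open>The circuit and its system\<close>

lemma inj_rvec: "inj rvec"
  by (auto simp: inj_def rvec_def vec_eq_iff)

lemma card_vec_product: "card {x::'a^'n::finite. \<forall>i. x $ i \<in> S i} = (\<Prod>i\<in>UNIV. card (S i))"
proof -
  have "card {x::'a^'n. \<forall>i. x $ i \<in> S i} = card (Pi\<^sub>E UNIV S)"
    by (rule bij_betw_same_card[of vec_nth], rule bij_betw_byWitness[of _ vec_lambda]) auto
  then show ?thesis by (simp add: card_PiE)
qed

lemma square_roots_of_real:
  assumes "0 < c"
  shows "{z::'a::real_field. z\<^sup>2 = of_real c} = {of_real (sqrt c), - of_real (sqrt c)}"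
proof -
  have "(of_real c :: 'a) = (of_real (sqrt c))\<^sup>2"
    using assms by (simp flip: of_real_power)
  then show ?thesis by (auto simp: power2_eq_iff)
qed

lemma card_square_roots_of_real:
  assumes "0 < c"
  shows "card {z::'a::real_field. z\<^sup>2 = of_real c} = 2"
proof -
  have "(of_real (sqrt c) :: 'a) \<noteq> - of_real (sqrt c)"
    using assms by (simp flip: of_real_minus)
  then show ?thesis unfolding square_roots_of_real[OF assms] by simp
qed

text \<open>\<open>Od\<close> is the set of indices whose vertex has an odd coordinate. A nonempty
  \<open>P \<union> N\<close> keeps the extra point away from the origin.\<close>

locale simplex_circuit =
  fixes Od P N :: "'n::finite set"
  assumes disjoint: "P \<inter> N = {}" and nonempty: "P \<union> N \<noteq> {}"
begin

definition deg :: "'n \<Rightarrow> nat" where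
  "deg i = (if i \<in> Od then 1 else 2)"

text \<open>Even values make the extra point vanish modulo 2 and prevent the weights from adding up
  to 1.\<close>

definition weight :: "'n \<Rightarrow> int" where
  "weight i = (if i \<in> P then 2 else if i \<in> N then - 2 else 0)"

definition vtx :: "'n \<Rightarrow> int^'n" where
  "vtx i = axis i (int (deg i))"

definition apex :: "int^'n" where
  "apex = (\<chi> i. weight i * int (deg i))"

definition circ :: "(int^'n) set" where
  "circ = insert 0 (insert apex (range vtx))"

lemma deg_pos: "0 < deg i" "deg i \<noteq> 0"
  by (simp_all add: deg_def)

lemma vtx_nth: "vtx i $ j = (if j = i then int (deg i) else 0)"
  by (simp add: vtx_def axis_def)

lemma apex_nth: "apex $ i = weight i * int (deg i)"
  by (simp add: apex_def)

lemma inj_vtx: "inj vtx"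
  by (auto simp: inj_def vtx_def axis_eq_axis deg_pos)

lemma distinct_points: "vtx i \<noteq> 0" "apex \<noteq> 0" "apex \<noteq> vtx i"
proof -
  show "vtx i \<noteq> 0"
    using deg_pos(2)[of i] by (metis of_nat_eq_0_iff vtx_nth zero_index)
  obtain k where "weight k \<noteq> 0"
    using nonempty unfolding weight_def by (metis UnE equals0I numeral_neq_zero neg_equal_0_iff_equal)
  then have "apex $ k \<noteq> 0 $ k" using deg_pos(2)[of k] by (simp add: apex_nth)
  then show "apex \<noteq> 0" by metis
  have "weight i \<noteq> 1" by (simp add: weight_def)
  then have "apex $ i \<noteq> vtx i $ i"
    using deg_pos(2)[of i] by (simp add: apex_nth vtx_nth)
  then show "apex \<noteq> vtx i" by metis
qed

lemma sum_circ: "(\<Sum>v\<in>circ. f v) = f 0 + f apex + (\<Sum>i\<in>UNIV. f (vtx i))"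
proof -
  have "0 \<notin> insert apex (range vtx)" "apex \<notin> range vtx"
    using distinct_points by (metis imageE insertE, metis imageE)
  then show ?thesis
    unfolding circ_def by (simp add: sum.reindex[OF inj_vtx] add.assoc)
qed

lemma finite_circ: "finite circ"
  by (simp add: circ_def)

lemma card_circ: "card circ = CARD('n) + 2"
  using sum_circ[of "\<lambda>_. 1::nat"] by simp

lemma rvec_vtx: "rvec (vtx i) = axis i (real (deg i))"
  by (simp add: rvec_def vec_eq_iff vtx_nth axis_def)

lemma rvec_apex: "rvec apex = (\<chi> i. real (deg i) * real_of_int (weight i))"
  by (simp add: rvec_def vec_eq_iff apex_nth)

lemma rvec_0: "rvec 0 = 0"
  by (simp add: rvec_def vec_eq_iff)

lemma is_circuit_circ: "is_circuit circ"
proof -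
  have 0: "0 \<in> rvec ` circ"
    using rvec_0 unfolding circ_def by (metis imageI insertI1)
  have "b \<in> span (rvec ` circ)" if "b \<in> Basis" for b
  proof -
    obtain i where i: "b = axis i 1" using \<open>b \<in> Basis\<close> by (auto simp: Basis_vec_def)
    have "b = (1 / real (deg i)) *\<^sub>R rvec (vtx i)"
      using deg_pos(2)[of i] by (simp add: i rvec_vtx vec_eq_iff axis_def)
    moreover have "rvec (vtx i) \<in> rvec ` circ" by (simp add: circ_def)
    ultimately show ?thesis by (simp add: span_scale span_base)
  qed
  then have "span (rvec ` circ) = UNIV"
    by (metis span_Basis span_mono span_span subsetI top.extremum_uniqueI)
  then have "affine hull (rvec ` circ) = UNIV"
    using affine_hull_span_0[OF hull_inc[OF 0]] by simp
  then show ?thesis by (simp add: is_circuit_def finite_circ card_circ)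
qed

section \<open>The minimal affinely dependent subset\<close>

lemma sum_weight: "(\<Sum>i\<in>UNIV. weight i) = 2 * int (card P) - 2 * int (card N)"
proof -
  have "(\<Sum>i\<in>UNIV. weight i) = (\<Sum>i\<in>UNIV. (if i \<in> P then 2 else 0) - (if i \<in> N then 2 else 0))"
    using disjoint by (intro sum.cong) (auto simp: weight_def)
  then show ?thesis by (simp add: sum_subtractf sum.If_cases)
qed

definition core :: "(int^'n) set" where
  "core = insert 0 (insert apex (vtx ` (P \<union> N)))"

lemma core_subset: "core \<subseteq> circ"
  by (auto simp: core_def circ_def)

text \<open>Extending the coefficients by zero to the whole circuit lets all subsets be treated with
  the same sums, which \<open>sum_circ\<close> evaluates.\<close>

lemma affine_dependent_rvec_iff_ex:
  assumes "D \<subseteq> circ"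
  shows "affine_dependent (rvec ` D) \<longleftrightarrow>
    (\<exists>f. (\<forall>v\<in>circ - D. f v = 0) \<and> (\<exists>v\<in>circ. f v \<noteq> 0) \<and>
       (\<Sum>v\<in>circ. f v) = 0 \<and> (\<Sum>v\<in>circ. f v *\<^sub>R rvec v) = 0)" (is "_ \<longleftrightarrow> ?R")
proof -
  have fin: "finite D" using finite_subset[OF assms finite_circ] .
  have inj: "inj_on rvec D" using inj_rvec by (rule inj_on_subset) simp
  show ?thesis
  proof
    assume "affine_dependent (rvec ` D)"
    then obtain U where U: "sum U (rvec ` D) = 0" "\<exists>v\<in>rvec ` D. U v \<noteq> 0"
      "(\<Sum>v\<in>rvec ` D. U v *\<^sub>R v) = 0"
      using affine_dependent_explicit_finite[of "rvec ` D"] fin by auto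
    define f where "f v = (if v \<in> D then U (rvec v) else 0)" for v
    have "(\<Sum>v\<in>circ. f v) = (\<Sum>v\<in>D. U (rvec v))"
      "(\<Sum>v\<in>circ. f v *\<^sub>R rvec v) = (\<Sum>v\<in>D. U (rvec v) *\<^sub>R rvec v)"
      using assms finite_circ by (auto simp: f_def intro!: sum.mono_neutral_cong_right)
    then show ?R
      using U assms by (intro exI[of _ f]) (auto simp: sum.reindex[OF inj] f_def)
  next
    assume ?R
    then obtain f where f: "\<forall>v\<in>circ - D. f v = 0" "\<exists>v\<in>circ. f v \<noteq> 0"
       "(\<Sum>v\<in>circ. f v) = 0" "(\<Sum>v\<in>circ. f v *\<^sub>R rvec v) = 0" by blast
    have "(\<Sum>v\<in>circ. f v) = (\<Sum>v\<in>D. f v)"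
      "(\<Sum>v\<in>circ. f v *\<^sub>R rvec v) = (\<Sum>v\<in>D. f v *\<^sub>R rvec v)"
      using assms finite_circ f(1) by (auto intro!: sum.mono_neutral_cong_right)
    moreover have inv: "inv rvec (rvec v) = v" for v :: "int^'n" by (rule inv_f_f[OF inj_rvec])
    moreover have "\<exists>v\<in>D. f v \<noteq> 0" using f(1,2) by blast
    ultimately show "affine_dependent (rvec ` D)"
      using f fin by (subst affine_dependent_explicit_finite)
        (auto simp: sum.reindex[OF inj] intro!: exI[of _ "f \<circ> inv rvec"])
  qed
qed

text \<open>Up to a factor the circuit satisfies one affine relation: its coefficients are -1 at the
  apex, \<open>weight i\<close> at the vertices and one minus the sum of the weights at the origin.
  The last one is odd, hence nonzero, and the support is \<open>core\<close>.\<close>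

lemma affine_dependent_rvec_iff:
  assumes D: "D \<subseteq> circ"
  shows "affine_dependent (rvec ` D) \<longleftrightarrow> core \<subseteq> D"
proof
  have odd: "(1::real) - (\<Sum>i\<in>UNIV. real_of_int (weight i)) \<noteq> 0"
  proof
    assume "(1::real) - (\<Sum>i\<in>UNIV. real_of_int (weight i)) = 0"
    then have "real_of_int (\<Sum>i\<in>UNIV. weight i) = real_of_int 1" by simp
    then have "(\<Sum>i\<in>UNIV. weight i) = 1" by (simp only: of_int_eq_iff)
    then show False using sum_weight by presburger
  qed
  {
    assume "affine_dependent (rvec ` D)"
    then obtain f where f: "\<forall>v\<in>circ - D. f v = 0" "\<exists>v\<in>circ. f v \<noteq> 0"
       "(\<Sum>v\<in>circ. f v) = 0" "(\<Sum>v\<in>circ. f v *\<^sub>R rvec v) = 0"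
      unfolding affine_dependent_rvec_iff_ex[OF D] by blast
    \<comment> \<open>Coordinate \<open>i\<close> of the vector relation involves only the apex and
      the \<open>i\<close>-th vertex.\<close>
    have vtx: "f (vtx i) = - f apex * weight i" for i
    proof -
      have "(\<Sum>v\<in>circ. f v *\<^sub>R rvec v) $ i = 0" using f(4) by simp
      then have "f apex * (real (deg i) * weight i) + (\<Sum>k\<in>UNIV. f (vtx k) * (if i = k then real (deg k) else 0)) = 0"
        by (simp add: sum_circ rvec_0 rvec_apex rvec_vtx axis_def)
      then have "f apex * (real (deg i) * weight i) + f (vtx i) * real (deg i) = 0"
        by (simp add: if_distrib cong: if_cong)
      then have "real (deg i) * (f apex * weight i + f (vtx i)) = 0" by (simp add: algebra_simps)
      then show ?thesis using deg_pos(2)[of i] by simp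
    qed
    have "f 0 + f apex + (\<Sum>i\<in>UNIV. - f apex * weight i) = 0"
      using f(3) by (simp add: sum_circ vtx)
    then have f0: "f 0 = - f apex * (1 - (\<Sum>i\<in>UNIV. real_of_int (weight i)))"
      by (simp add: algebra_simps sum_distrib_left sum_negf)
    have "f apex \<noteq> 0"
    proof
      assume "f apex = 0"
      then have "\<forall>v\<in>circ. f v = 0" using vtx f0 by (auto simp: circ_def)
      then show False using f(2) by blast
    qed
    moreover have "weight i \<noteq> 0" if "i \<in> P \<union> N" for i using that by (auto simp: weight_def)
    ultimately have "f v \<noteq> 0" if "v \<in> core" for v
      using that f0 odd unfolding core_def by (elim insertE imageE) (simp_all add: vtx)
    then show "core \<subseteq> D" using f(1) core_subset by blast
  }
  {
    assume "core \<subseteq> D"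
    define f where "f v = (if v = 0 then 1 - (\<Sum>i\<in>UNIV. real_of_int (weight i)) else
      if v = apex then - 1 else real_of_int (weight (inv vtx v)))" for v
    have f_vtx: "f (vtx i) = weight i" for i
      using distinct_points(1)[of i] distinct_points(3)[of i] inv_f_f[OF inj_vtx, of i] by (simp add: f_def)
    have f_0: "f 0 = 1 - (\<Sum>i\<in>UNIV. real_of_int (weight i))" "f apex = - 1"
      using distinct_points by (auto simp: f_def)
    show "affine_dependent (rvec ` D)"
      unfolding affine_dependent_rvec_iff_ex[OF D]
    proof (intro exI[of _ f] conjI ballI)
      show "\<exists>v\<in>circ. f v \<noteq> 0" by (rule bexI[of _ apex]) (auto simp: f_0 circ_def)
      show "(\<Sum>v\<in>circ. f v) = 0" by (simp add: sum_circ f_vtx f_0)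
      show "(\<Sum>v\<in>circ. f v *\<^sub>R rvec v) = 0"
        by (simp add: sum_circ f_vtx f_0 vec_eq_iff rvec_0 rvec_apex rvec_vtx axis_def if_distrib cong: if_cong)
      fix v assume v: "v \<in> circ - D"
      then obtain i where "v = vtx i" "i \<notin> P \<union> N"
        using \<open>core \<subseteq> D\<close> by (auto simp: circ_def core_def)
      then show "f v = 0" by (simp add: f_vtx weight_def)
    qed
  }
qed

text \<open>Dropping the apex from \<open>core\<close> leaves an affinely independent set of
  \<open>card (P \<union> N) + 1\<close> points, whose affine hull still contains the apex because
  \<open>core\<close> is dependent.\<close>

lemma circuit_m_circ: "circuit_m circ = int (card (P \<union> N))"
proof -
  have "min_aff_dep circ D \<longleftrightarrow> D = core" for D
  proof
    assume D: "min_aff_dep circ D"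
    then have "D \<subseteq> circ" and "core \<subseteq> D"
      using affine_dependent_rvec_iff by (auto simp: min_aff_dep_def)
    moreover have "\<not> core \<subset> D"
      using D affine_dependent_rvec_iff[OF core_subset] by (auto simp: min_aff_dep_def)
    ultimately show "D = core" by blast
  next
    assume "D = core"
    moreover have "\<not> affine_dependent (rvec ` D')" if "D' \<subset> core" for D'
      using that core_subset affine_dependent_rvec_iff[of D'] by blast
    ultimately show "min_aff_dep circ D"
      using core_subset affine_dependent_rvec_iff[OF core_subset] by (auto simp: min_aff_dep_def)
  qed
  then have m: "circuit_m circ = aff_dim (rvec ` core)"
    by (simp add: circuit_m_def)
  let ?S = "insert 0 (vtx ` (P \<union> N))"
  have apex: "apex \<notin> ?S" using distinct_points by auto
  have "?S \<subseteq> circ" by (auto simp: circ_def)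
  moreover have "\<not> core \<subseteq> ?S" using apex by (auto simp: core_def)
  ultimately have ind: "\<not> affine_dependent (rvec ` ?S)"
    by (simp only: affine_dependent_rvec_iff not_False_eq_True)
  have core: "rvec ` core = insert (rvec apex) (rvec ` ?S)"
    by (auto simp: core_def)
  have "rvec apex \<in> affine hull (rvec ` ?S)"
    using affine_independent_insert[OF ind, of "rvec apex"] affine_dependent_rvec_iff[OF core_subset] core by auto
  then have "aff_dim (rvec ` core) = aff_dim (rvec ` ?S)"
    unfolding core by (subst aff_dim_insert) simp
  also have "\<dots> = int (card (rvec ` ?S)) - 1"
    using aff_dim_affine_independent[OF ind] by simp
  also have "card (rvec ` ?S) = card ?S"
    using inj_rvec by (intro card_image) (rule inj_on_subset, auto)
  also have "card ?S = Suc (card (P \<union> N))"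
  proof -
    have "0 \<notin> vtx ` (P \<union> N)" using distinct_points(1) by (metis imageE)
    moreover have "card (vtx ` (P \<union> N)) = card (P \<union> N)"
      by (intro card_image inj_on_subset[OF inj_vtx subset_UNIV])
    ultimately show ?thesis by simp
  qed
  finally show ?thesis by (simp add: m)
qed

text \<open>Modulo 2 the circuit reduces to the origin and the basis vectors with index in
  \<open>Od\<close>. Whichever base point is subtracted, the nonzero columns form an independent
  family indexed by \<open>Od\<close>.\<close>

lemma rk2_circ: "rk2 circ = card Od"
proof -
  define w' where "w' = (SOME w'. w' \<in> circ)"
  have w': "w' \<in> circ" unfolding w'_def by (rule someI[of _ 0]) (simp add: circ_def)
  define V where "V = red2 ` ((\<lambda>w. w - w') ` circ)"
  define e :: "'n \<Rightarrow> int^'n" where "e i = (if i \<in> Od then axis i 1 else 0)" for i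
  have red_cong: "red2 (a - b) = red2 (a' - b')" if "red2 a = red2 a'" "red2 b = red2 b'"
    for a a' b b' :: "int^'n"
    using that by (auto simp: red2_def vec_eq_iff intro: mod_diff_cong)
  have red_vtx: "red2 (vtx i) = red2 (e i)" for i
    by (auto simp: red2_def vec_eq_iff vtx_nth e_def axis_def deg_def)
  have red_apex: "red2 apex = red2 0"
    by (auto simp: red2_def vec_eq_iff apex_nth weight_def)
  have "w' = 0 \<or> w' = apex \<or> (\<exists>i. w' = vtx i)" using w' by (auto simp: circ_def)
  \<comment> \<open>Only the class of the base point modulo 2 matters, so it may be replaced by the
    origin or a basis vector.\<close>
  then have "\<exists>w. (w = 0 \<or> (\<exists>k\<in>Od. w = e k)) \<and> red2 w' = red2 w"
    using red_vtx red_apex e_def by metis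
  then obtain w where w: "w = 0 \<or> (\<exists>k\<in>Od. w = e k)" "red2 w' = red2 w" by blast
  have V_eq: "V = insert (red2 (0 - w)) ((\<lambda>i. red2 (e i - w)) ` Od)"
  proof -
    have "V = (\<lambda>v. red2 (v - w)) ` circ"
      unfolding V_def image_image by (intro image_cong refl red_cong w(2))
    also have "\<dots> = insert (red2 (0 - w)) ((\<lambda>i. red2 (e i - w)) ` UNIV)"
      unfolding circ_def image_insert image_image
        red_cong[OF red_vtx refl] red_cong[OF red_apex refl] by simp
    also have "\<dots> = insert (red2 (0 - w)) ((\<lambda>i. red2 (e i - w)) ` Od)"
      by (auto simp: e_def)
    finally show ?thesis .
  qed
  have red_0: "red2 0 = (0 :: int^'n)" by (simp add: red2_def vec_eq_iff)
  have "\<exists>g. V = insert 0 (g ` Od) \<and> (\<forall>I. I \<subseteq> Od \<longrightarrow> I \<noteq> {} \<longrightarrow> (\<exists>j. odd (\<Sum>i\<in>I. g i $ j)))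
      \<and> inj_on g Od"
    using w(1)
  proof
    assume w0: "w = 0"
    have sum_eq: "(\<Sum>i\<in>I. (axis i 1 :: int^'n) $ j) = (if j \<in> I then 1 else 0)" for I :: "'n set" and j
      by (simp add: axis_def)
    have "red2 (e i - 0) = axis i 1" if "i \<in> Od" for i
      using that by (auto simp: red2_def vec_eq_iff e_def axis_def)
    then have "V = insert 0 ((\<lambda>i. axis i 1) ` Od)"
      unfolding V_eq w0 by (simp add: red_0)
    then show ?thesis
      by (intro exI[of _ "\<lambda>i. axis i 1"]) (auto simp: sum_eq inj_on_def axis_eq_axis)
  next
    assume "\<exists>k\<in>Od. w = e k"
    then obtain k where k: "k \<in> Od" "w = axis k 1" by (auto simp: e_def)
    \<comment> \<open>Modulo 2, subtracting the base point \<open>axis k 1\<close> means adding it.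
      The column \<open>axis k 1\<close> now comes from the origin, and the zero column from the
      base point.\<close>
    define g :: "'n \<Rightarrow> int^'n" where "g i = (if i = k then axis k 1 else axis i 1 + axis k 1)" for i
    have red: "red2 (e i - w) = g i" if "i \<in> Od" "i \<noteq> k" for i
      using that k by (auto simp: red2_def vec_eq_iff e_def g_def axis_def)
    have Od: "Od = insert k (Od - {k})" using k by blast
    have "V = insert (red2 (0 - w)) (insert (red2 (e k - w)) ((\<lambda>i. red2 (e i - w)) ` (Od - {k})))"
      unfolding V_eq by (subst Od) (simp only: image_insert)
    also have "(\<lambda>i. red2 (e i - w)) ` (Od - {k}) = g ` (Od - {k})"
      by (intro image_cong refl red) auto
    also have "red2 (e k - w) = 0" using k by (simp add: e_def red_0)
    also have "red2 (0 - w) = g k" using k by (auto simp: g_def red2_def vec_eq_iff axis_def)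
    also have "insert (g k) (insert 0 (g ` (Od - {k}))) = insert 0 (g ` Od)" using k(1) by blast
    finally have V: "V = insert 0 (g ` Od)" .
    have off: "g i $ j = (if i = j then 1 else 0)" if "j \<noteq> k" for i j
      using that by (auto simp: g_def axis_def)
    \<comment> \<open>For \<open>j \<noteq> k\<close> only \<open>g j\<close> has a nonzero
      coordinate \<open>j\<close>, so any \<open>j\<close> in \<open>I\<close> other than
      \<open>k\<close> gives the odd sum 1.\<close>
    have odd: "\<exists>j. odd (\<Sum>i\<in>I. g i $ j)" if ne: "I \<noteq> {}" for I
    proof (cases "I = {k}")
      case True
      then show ?thesis by (intro exI[of _ k]) (simp add: g_def axis_def)
    next
      case False
      then obtain j where "j \<in> I" "j \<noteq> k" using ne by blast
      then show ?thesis by (intro exI[of _ j]) (simp add: off)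
    qed
    have "i = j" if "g i = g j" "i \<noteq> k" for i j
      using off[OF that(2)] that(1) by (metis zero_neq_one)
    then have "inj g" by (metis injI)
    then show ?thesis using V odd inj_on_subset by blast
  qed
  then obtain g where g: "V = insert 0 (g ` Od)" "inj_on g Od"
    "\<And>I. I \<subseteq> Od \<Longrightarrow> I \<noteq> {} \<Longrightarrow> \<exists>j. odd (\<Sum>i\<in>I. g i $ j)" by blast
  \<comment> \<open>Zero cannot belong to an independent set, so at most \<open>card Od\<close>
    columns remain.\<close>
  have le: "card S \<le> card Od" if "S \<subseteq> V" "indep2 S" for S
  proof -
    have "0 \<notin> S"
      using that(2) unfolding indep2_def by (auto dest!: spec[of _ "{0}"])
    then have "S \<subseteq> g ` Od" using that(1) g(1) by blast
    then have "card S \<le> card (g ` Od)" by (intro card_mono) auto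
    also have "\<dots> \<le> card Od" by (intro card_image_le) simp
    finally show ?thesis .
  qed
  have "indep2 (g ` Od)"
    unfolding indep2_def
  proof (intro allI impI)
    fix T assume "T \<subseteq> g ` Od" "T \<noteq> {}"
    then obtain I where I: "I \<subseteq> Od" "T = g ` I" "I \<noteq> {}" by (metis image_is_empty subset_imageE)
    then have "(\<Sum>v\<in>T. v $ j) = (\<Sum>i\<in>I. g i $ j)" for j
      using sum.reindex[OF inj_on_subset[OF g(2) I(1)]] by simp
    then show "\<exists>i. odd (\<Sum>v\<in>T. v $ i)" using g(3)[OF I(1,3)] by simp
  qed
  moreover have "card (g ` Od) = card Od" by (intro card_image g(2))
  ultimately have "\<exists>S. card Od = card S \<and> S \<subseteq> V \<and> indep2 S"
    using g(1) by (metis subset_insertI)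
  moreover have "finite {card S |S. S \<subseteq> V \<and> indep2 S}"
    by (rule finite_subset[of _ "{..card Od}"]) (use le in auto)
  ultimately have "Max {card S |S. S \<subseteq> V \<and> indep2 S} = card Od"
    by (intro Max_eqI) (use le in auto)
  then show ?thesis by (simp add: rk2_def Let_def V_def w'_def)
qed

section \<open>The normalized volume of the circuit\<close>

lemma prod_deg: "(\<Prod>i\<in>UNIV. deg i) = 2 ^ (CARD('n) - card Od)"
proof -
  have "(\<Prod>i\<in>UNIV. deg i) = (\<Prod>i\<in>- Od. 2)"
    unfolding deg_def by (subst prod.If_cases) (auto simp: Compl_eq)
  then show ?thesis by (simp add: Compl_eq_Diff_UNIV card_Diff_subset)
qed

lemma norm_vol_circ:
  "norm_vol circ = 2 ^ (CARD('n) - card Od) * max (2 * card P) (2 * card N + 1)"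
proof -
  define d :: "real^'n" where "d = (\<chi> i. real (deg i))"
  define u :: "real^'n" where "u = (\<chi> i. real_of_int (weight i))"
  have d: "0 < d $ i" for i by (simp add: d_def deg_pos)
  have "rvec ` circ = insert (\<chi> i. d $ i * u $ i) (insert 0 (range (\<lambda>i. axis i (d $ i))))"
    by (simp add: circ_def image_image rvec_0 rvec_apex rvec_vtx d_def u_def insert_commute)
  moreover have "{i. 0 < u $ i} = P" "{i. u $ i < 0} = N"
    using disjoint by (auto simp: u_def weight_def split: if_splits)
  moreover have "(\<Sum>i\<in>P. u $ i) = 2 * card P"
    by (simp add: u_def weight_def)
  moreover have "(\<Sum>i\<in>N. - u $ i) = (\<Sum>i\<in>N. 2)"
    using disjoint by (intro sum.cong) (auto simp: u_def weight_def)
  moreover have "(\<Prod>i\<in>UNIV. d $ i) = 2 ^ (CARD('n) - card Od)"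
    unfolding d_def vec_lambda_beta of_nat_prod[symmetric] prod_deg by simp
  ultimately show ?thesis
    unfolding norm_vol_def by (simp add: measure_hull_stretched_apex[OF d] max_def)
qed

section \<open>Mixing the equations to obtain full support\<close>

definition mixed_coeffs :: "('n \<Rightarrow> real) \<Rightarrow> real \<Rightarrow> 'n \<Rightarrow> int^'n \<Rightarrow> real" where
  "mixed_coeffs b t j v =
     (if v = 0 then - (1 + t * CARD('n))
      else if v = apex then - (b j + t * (\<Sum>i\<in>UNIV. b i))
      else if v \<in> range vtx then (if v = vtx j then 1 else 0) + t
      else 0)"

lemma mixed_coeffs_vtx: "mixed_coeffs b t j (vtx i) = (if i = j then 1 else 0) + t"
  using distinct_points(1)[of i] distinct_points(3)[of i] inj_eq[OF inj_vtx, of i j]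
  by (simp add: mixed_coeffs_def)

text \<open>Adding \<open>t\<close> times the sum of all equations to each of them gives every
  vertex the positive coefficient \<open>t\<close> or \<open>1 + t\<close>; the second hypothesis
  takes care of the apex.\<close>

lemma supported_on_coeffs:
  assumes "0 < t" "\<And>j. b j + t * (\<Sum>i\<in>UNIV. b i) \<noteq> 0"
  shows "supported_on (mixed_coeffs b t) circ"
  unfolding supported_on_def
proof (intro allI)
  fix j v
  have "1 + t * real CARD('n) > 0" using assms(1) by (intro add_pos_nonneg) auto
  then show "mixed_coeffs b t j v \<noteq> 0 \<longleftrightarrow> v \<in> circ"
    using assms(1) assms(2)[of j] by (auto simp: mixed_coeffs_def circ_def)
qed

text \<open>Each apex coefficient vanishes for at most one \<open>t\<close>.\<close>

lemma exists_mixing_parameter: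
  fixes b :: "'n \<Rightarrow> real"
  assumes "\<And>i. b i \<noteq> 0"
  shows "\<exists>t>0. \<forall>j. b j + t * (\<Sum>i\<in>UNIV. b i) \<noteq> 0"
proof (cases "(\<Sum>i\<in>UNIV. b i) = 0")
  case True
  then show ?thesis using assms by (intro exI[of _ 1]) auto
next
  case False
  have "infinite ({0<..} - range (\<lambda>j. - b j / (\<Sum>i\<in>UNIV. b i)))"
    by (intro Diff_infinite_finite) (simp_all add: infinite_Ioi)
  then obtain t where t: "0 < t" "t \<notin> range (\<lambda>j. - b j / (\<Sum>i\<in>UNIV. b i))"
    by (metis Diff_iff ex_in_conv finite.emptyI greaterThan_iff)
  have "b j + t * (\<Sum>i\<in>UNIV. b i) \<noteq> 0" for j
  proof
    assume "b j + t * (\<Sum>i\<in>UNIV. b i) = 0"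
    then have "t = - b j / (\<Sum>i\<in>UNIV. b i)" using False by (simp add: field_simps)
    then show False using t(2) by blast
  qed
  with t(1) show ?thesis by blast
qed

text \<open>This grouping shows that the monomial of the apex depends only on the powers
  \<open>x $ i ^ deg i\<close>, which makes the elimination possible.\<close>

definition monomial :: "'a::real_field^'n \<Rightarrow> 'a" where
  "monomial x = (\<Prod>i\<in>UNIV. (x $ i ^ deg i) powi weight i)"

lemma Feval_coeffs:
  fixes x :: "'a::real_field^'n"
  shows "Feval (mixed_coeffs b t) circ j x =
    (x $ j ^ deg j - 1 - of_real (b j) * monomial x) +
    of_real t * (\<Sum>i\<in>UNIV. x $ i ^ deg i - 1 - of_real (b i) * monomial x)"
proof -
  have vtx: "(\<Prod>k\<in>UNIV. x $ k powi (vtx i $ k)) = x $ i ^ deg i" for i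
  proof -
    have "(\<Prod>k\<in>UNIV. x $ k powi (vtx i $ k)) = (\<Prod>k\<in>UNIV. if k = i then x $ k ^ deg k else 1)"
      by (intro prod.cong) (auto simp: vtx_nth)
    then show ?thesis by simp
  qed
  have apex: "(\<Prod>k\<in>UNIV. x $ k powi (apex $ k)) = monomial x"
    by (simp add: monomial_def apex_nth mult.commute power_int_mult)
  have "(\<Sum>i\<in>UNIV. of_real (mixed_coeffs b t j (vtx i)) * x $ i ^ deg i) =
      (\<Sum>i\<in>UNIV. (if i = j then x $ i ^ deg i else 0) + of_real t * x $ i ^ deg i)"
    by (intro sum.cong) (auto simp: mixed_coeffs_vtx algebra_simps)
  then have v: "(\<Sum>i\<in>UNIV. of_real (mixed_coeffs b t j (vtx i)) * x $ i ^ deg i) =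
      x $ j ^ deg j + of_real t * (\<Sum>i\<in>UNIV. x $ i ^ deg i)"
    by (simp add: sum.distrib sum_distrib_left)
  have c: "mixed_coeffs b t j 0 = - (1 + t * CARD('n))"
    "mixed_coeffs b t j apex = - (b j + t * (\<Sum>i\<in>UNIV. b i))"
    using distinct_points(2) by (simp_all add: mixed_coeffs_def)
  have s: "(\<Sum>i\<in>UNIV. x $ i ^ deg i - 1 - of_real (b i) * monomial x) =
      (\<Sum>i\<in>UNIV. x $ i ^ deg i) - of_nat CARD('n) - of_real (\<Sum>i\<in>UNIV. b i) * monomial x"
    by (simp add: sum_subtractf sum_distrib_right)
  show ?thesis
    unfolding Feval_def sum_circ vtx apex v c s by (simp add: algebra_simps del: of_real_sum)
qed

text \<open>The matrix \<open>I + t J\<close> is invertible for \<open>t > 0\<close>, so mixing the equations does not change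
  the solutions.\<close>

lemma Feval_coeffs_eq_0_iff:
  fixes x :: "'a::real_field^'n"
  assumes "0 < t"
  shows "(\<forall>j. Feval (mixed_coeffs b t) circ j x = 0) \<longleftrightarrow> (\<forall>i. x $ i ^ deg i = 1 + of_real (b i) * monomial x)"
proof -
  define h where "h i = x $ i ^ deg i - 1 - of_real (b i) * monomial x" for i
  have F: "Feval (mixed_coeffs b t) circ j x = h j + of_real t * (\<Sum>i\<in>UNIV. h i)" for j
    unfolding Feval_coeffs h_def ..
  have "(\<forall>i. h i = 0)" if zero: "\<And>j. Feval (mixed_coeffs b t) circ j x = 0"
  proof -
    have "(\<Sum>j\<in>UNIV. h j + of_real t * (\<Sum>i\<in>UNIV. h i)) = 0"
      using zero by (simp add: F)
    then have "of_real (1 + real CARD('n) * t) * (\<Sum>i\<in>UNIV. h i) = 0"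
      by (simp add: sum.distrib algebra_simps)
    moreover have "1 + real CARD('n) * t > 0" using assms by (intro add_pos_nonneg) auto
    then have "(of_real (1 + real CARD('n) * t) :: 'a) \<noteq> 0"
      by (metis of_real_eq_0_iff less_irrefl)
    ultimately have "(\<Sum>i\<in>UNIV. h i) = 0" by (metis mult_eq_0_iff)
    then show ?thesis using zero by (simp add: F)
  qed
  moreover have "(\<forall>i. h i = 0) \<Longrightarrow> Feval (mixed_coeffs b t) circ j x = 0" for j
    by (simp add: F)
  moreover have "h i = 0 \<longleftrightarrow> x $ i ^ deg i = 1 + of_real (b i) * monomial x" for i
    by (simp add: h_def algebra_simps)
  ultimately show ?thesis by blast
qed

text \<open>The factors over \<open>N\<close> clear the negative exponents.\<close>

lemma prod_powi_weight:
  fixes g :: "'n \<Rightarrow> 'a::field"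
  assumes "\<And>i. g i \<noteq> 0"
  shows "(\<Prod>i\<in>UNIV. g i powi weight i) * (\<Prod>i\<in>N. (g i)\<^sup>2) = (\<Prod>i\<in>P. (g i)\<^sup>2)"
proof -
  have "(\<Prod>i\<in>UNIV. g i powi weight i) * (\<Prod>i\<in>N. (g i)\<^sup>2) =
      (\<Prod>i\<in>UNIV. g i powi weight i * (if i \<in> N then (g i)\<^sup>2 else 1))"
    by (simp add: prod.distrib prod.If_cases)
  also have "\<dots> = (\<Prod>i\<in>UNIV. if i \<in> P then (g i)\<^sup>2 else 1)"
    using assms disjoint by (intro prod.cong) (auto simp: weight_def power_int_minus power_int_numeral)
  also have "\<dots> = (\<Prod>i\<in>P. (g i)\<^sup>2)" by (simp add: prod.If_cases)
  finally show ?thesis .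
qed

section \<open>Counting the solutions above a complete set of real roots\<close>

context
  fixes b :: "'n \<Rightarrow> real" and t :: real and Y :: "real set"
  assumes t: "0 < t" and b: "\<And>i. b i \<noteq> 0"
    and card_Y: "card Y = max (2 * card P) (2 * card N + 1)"
    and root: "\<And>y. y \<in> Y \<Longrightarrow> y * (\<Prod>i\<in>N. (1 + b i * y)\<^sup>2) = (\<Prod>i\<in>P. (1 + b i * y)\<^sup>2)"
    and even_pos: "\<And>y i. y \<in> Y \<Longrightarrow> i \<notin> Od \<Longrightarrow> 0 < 1 + b i * y"
    and nonzero: "\<And>y i. y \<in> Y \<Longrightarrow> 1 + b i * y \<noteq> 0"
begin

text \<open>The monomial of a solution satisfies the eliminated equation and so equals some
  \<open>y\<close> in \<open>Y\<close>. Conversely, for any choice of coordinates over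
  \<open>y\<close> the monomial is again \<open>y\<close>, since the nonzero factors over
  \<open>N\<close> cancel.\<close>

lemma solutions_eq:
  "{x::'a::real_field^'n. (\<forall>i. x $ i \<noteq> 0) \<and> (\<forall>j. Feval (mixed_coeffs b t) circ j x = 0)} =
    (\<Union>y\<in>Y. {x. \<forall>i. x $ i \<in> {z. z ^ deg i = of_real (1 + b i * y)}})"
proof (intro equalityI subsetI)
  fix x :: "'a^'n"
  assume "x \<in> {x. (\<forall>i. x $ i \<noteq> 0) \<and> (\<forall>j. Feval (mixed_coeffs b t) circ j x = 0)}"
  then have x: "\<And>i. x $ i \<noteq> 0" "\<And>i. x $ i ^ deg i = 1 + of_real (b i) * monomial x"
    by (auto simp: Feval_coeffs_eq_0_iff[OF t])
  have "monomial x * (\<Prod>i\<in>N. (x $ i ^ deg i)\<^sup>2) = (\<Prod>i\<in>P. (x $ i ^ deg i)\<^sup>2)"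
    unfolding monomial_def using x(1) by (intro prod_powi_weight) simp
  moreover have "{z::'a. z * (\<Prod>i\<in>N. (1 + of_real (b i) * z)\<^sup>2) = (\<Prod>i\<in>P. (1 + of_real (b i) * z)\<^sup>2)} = of_real ` Y"
    by (rule roots_eq_real_roots[OF b card_Y root])
  ultimately have "monomial x \<in> of_real ` Y"
    unfolding x(2) by blast
  then show "x \<in> (\<Union>y\<in>Y. {x. \<forall>i. x $ i \<in> {z. z ^ deg i = of_real (1 + b i * y)}})"
    using x(2) by auto
next
  fix x :: "'a^'n"
  assume "x \<in> (\<Union>y\<in>Y. {x. \<forall>i. x $ i \<in> {z. z ^ deg i = of_real (1 + b i * y)}})"
  then obtain y where y: "y \<in> Y" "\<And>i. x $ i ^ deg i = of_real (1 + b i * y)" by auto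
  have nz: "x $ i ^ deg i \<noteq> 0" for i
    unfolding y(2) of_real_eq_0_iff by (rule nonzero[OF y(1)])
  have "(of_real y :: 'a) * (\<Prod>i\<in>N. (x $ i ^ deg i)\<^sup>2) = of_real (y * (\<Prod>i\<in>N. (1 + b i * y)\<^sup>2))"
    by (simp add: y(2))
  also have "\<dots> = (\<Prod>i\<in>P. (x $ i ^ deg i)\<^sup>2)"
    unfolding root[OF y(1)] by (simp add: y(2))
  also have "\<dots> = monomial x * (\<Prod>i\<in>N. (x $ i ^ deg i)\<^sup>2)"
    unfolding monomial_def using nz by (intro prod_powi_weight[symmetric])
  finally have "of_real y * (\<Prod>i\<in>N. (x $ i ^ deg i)\<^sup>2) = monomial x * (\<Prod>i\<in>N. (x $ i ^ deg i)\<^sup>2)" .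
  moreover have x: "x $ i \<noteq> 0" for i using nz[of i] deg_pos(1)[of i] by auto
  ultimately have "monomial x = of_real y" by simp
  with x show "x \<in> {x. (\<forall>i. x $ i \<noteq> 0) \<and> (\<forall>j. Feval (mixed_coeffs b t) circ j x = 0)}"
    using y(2) by (auto simp: Feval_coeffs_eq_0_iff[OF t])
qed

text \<open>The coordinates vary independently: one value for an index in \<open>Od\<close>, and two
  square roots of a positive number otherwise. The count is thus the same over the real and the
  complex numbers.\<close>

lemma card_fibre:
  assumes "y \<in> Y"
  shows "card {x::'a::real_field^'n. \<forall>i. x $ i \<in> {z. z ^ deg i = of_real (1 + b i * y)}} =
    2 ^ (CARD('n) - card Od)"
proof -
  have "card {z::'a. z ^ deg i = of_real (1 + b i * y)} = deg i" for i
    using card_square_roots_of_real[OF even_pos[OF assms, of i]] by (cases "i \<in> Od") (simp_all add: deg_def)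
  then show ?thesis by (simp only: card_vec_product prod_deg)
qed

lemma card_solutions:
  "card {x::'a::real_field^'n. (\<forall>i. x $ i \<noteq> 0) \<and> (\<forall>j. Feval (mixed_coeffs b t) circ j x = 0)} =
    2 ^ (CARD('n) - card Od) * card Y" (is ?card)
  and finite_solutions:
  "finite {x::'a::real_field^'n. (\<forall>i. x $ i \<noteq> 0) \<and> (\<forall>j. Feval (mixed_coeffs b t) circ j x = 0)}" (is ?fin)
proof -
  let ?X = "\<lambda>y. {x::'a^'n. \<forall>i. x $ i \<in> {z. z ^ deg i = of_real (1 + b i * y)}}"
  have finY: "finite Y" by (rule card_ge_0_finite) (simp add: card_Y)
  have finX: "finite (?X y)" if "y \<in> Y" for y
    by (rule card_ge_0_finite) (simp only: card_fibre[OF that], simp)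
  have "?X y \<inter> ?X y' = {}" if "y \<noteq> y'" for y y'
  proof (rule ccontr)
    assume "?X y \<inter> ?X y' \<noteq> {}"
    then obtain x where x: "x \<in> ?X y" "x \<in> ?X y'" by blast
    \<comment> \<open>Any coordinate separates the fibres, because \<open>b i\<close> is
      nonzero.\<close>
    fix i
    have "x $ i ^ deg i = of_real (1 + b i * y)" "x $ i ^ deg i = of_real (1 + b i * y')"
      using x by blast+
    then have "1 + b i * y = 1 + b i * y'" by (simp only: of_real_eq_iff)
    then show False using b[of i] that by simp
  qed
  then have "card (\<Union>y\<in>Y. ?X y) = (\<Sum>y\<in>Y. card (?X y))"
    using finX by (intro card_UN_disjoint finY) auto
  also have "\<dots> = (\<Sum>y\<in>Y. 2 ^ (CARD('n) - card Od))"
    by (intro sum.cong refl card_fibre)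
  finally show ?card unfolding solutions_eq by simp
  show ?fin unfolding solutions_eq using finX by (intro finite_UN_I finY)
qed

lemma card_real_sols: "card (real_sols (mixed_coeffs b t) circ) = 2 ^ (CARD('n) - card Od) * card Y"
  unfolding real_sols_def by (rule card_solutions)

text \<open>The complex count agrees with the volume because \<open>card_Y\<close> contains the same
  maximum as \<open>norm_vol_circ\<close>.\<close>

lemma generic_system_coeffs: "generic_system (mixed_coeffs b t) circ"
  unfolding generic_system_def complex_sols_def card_solutions norm_vol_circ
  using finite_solutions by (simp add: card_Y)

end

end

section \<open>Choice of the index sets and of the coefficients\<close>

theorem theorem3p7:
  fixes m R :: nat
  assumes "1 \<le> m" and "m \<le> CARD('n::finite)" and "R \<le> CARD('n)"
  shows "\<exists>(C :: (int^'n) set) (c :: 'n \<Rightarrow> int^'n \<Rightarrow> real).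
           is_circuit C \<and> circuit_m C = int m \<and> rk2 C = R \<and>
           supported_on c C \<and> generic_system c C \<and>
           (R \<le> m \<longrightarrow> card (real_sols c C) = 2 ^ (CARD('n) - R) * (m + R + 1)) \<and>
           (m \<le> R \<longrightarrow> card (real_sols c C) = 2 ^ (CARD('n) - R) * (2 * m + 1))"
proof -
  \<comment> \<open>Nested sets give the largest possible overlap, \<open>min m R\<close>, and each
    index in the overlap contributes two roots instead of one.\<close>
  obtain M Od :: "'n set" where M: "card M = m" "card Od = R" "Od \<subseteq> M \<or> M \<subseteq> Od"
  proof (cases "R \<le> m")
    case True
    obtain M :: "'n set" where "card M = m"
      using obtain_subset_with_card_n[OF assms(2)] by blast
    moreover then obtain Od where "Od \<subseteq> M" "card Od = R"
      using obtain_subset_with_card_n[of R M] True by blast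
    ultimately show ?thesis using that by blast
  next
    case False
    obtain Od :: "'n set" where "card Od = R"
      using obtain_subset_with_card_n[OF assms(3)] by blast
    moreover then obtain M where "M \<subseteq> Od" "card M = m"
      using obtain_subset_with_card_n[of m Od] False by (metis nat_le_linear)
    ultimately show ?thesis using that by blast
  qed
  have card_S: "card (M \<inter> Od) = min m R"
    using M(3)
  proof
    assume "Od \<subseteq> M"
    then show ?thesis using M card_mono[of M Od] by (simp add: Int_absorb1 min_def)
  next
    assume "M \<subseteq> Od"
    then show ?thesis using M card_mono[of Od M] by (simp add: Int_absorb2 min_def)
  qed
  have card_K: "card (M - Od) + card (M \<inter> Od) = m"
    using M(1) card_Int_Diff[of M Od] by simp
  define d where "d = card (M - Od) + 2 * card (M \<inter> Od) + 1"
  have d: "d = m + min m R + 1" using card_K card_S by (simp add: d_def)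
  \<comment> \<open>The indices in \<open>M \<inter> Od\<close> receive negative parameters and
    those in \<open>M - Od\<close> positive ones.\<close>
  have "M \<inter> Od \<inter> (M - Od) = {}" by blast
  from exists_alternating[OF finite_class.finite finite_class.finite this, folded d_def]
  obtain P N and b0 :: "'n \<Rightarrow> real" where PN: "P \<union> N = M \<inter> Od \<union> (M - Od)" "P \<inter> N = {}"
    and b0: "\<forall>i\<in>M - Od. 0 < b0 i" "\<forall>i\<in>M \<inter> Od. b0 i < 0"
    and alt: "M \<inter> Od \<subseteq> N \<and> 2 * card N + 1 = d \<and> card P \<le> card N \<and>
       alternating ([:0, 1:] * sqprod b0 N) (sqprod b0 P) d \<or>
     M \<inter> Od \<subseteq> P \<and> 2 * card P = d \<and> card N < card P \<and>
       alternating (sqprod b0 P) ([:0, 1:] * sqprod b0 N) d"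
    unfolding Suc_eq_plus1 d_def[symmetric] by blast
  have PN_M: "P \<union> N = M" using PN(1) by blast
  have "\<exists>Y. finite Y \<and> card Y = d \<and>
      (\<forall>y\<in>Y. 0 < y \<and> poly ([:0, 1:] * sqprod b0 N) y = poly (sqprod b0 P) y)"
    using alt
  proof (elim disjE conjE)
    assume "alternating (sqprod b0 P) ([:0, 1:] * sqprod b0 N) d"
    from alternating_roots[OF this] show ?thesis by metis
  qed (rule alternating_roots)
  then obtain Y where Y: "finite Y" "card Y = d" "\<And>y. y \<in> Y \<Longrightarrow> 0 < y"
    "\<And>y. y \<in> Y \<Longrightarrow> y * (\<Prod>i\<in>N. (1 + b0 i * y)\<^sup>2) = (\<Prod>i\<in>P. (1 + b0 i * y)\<^sup>2)"
    by (auto simp: poly_sqprod)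
  \<comment> \<open>Indices outside \<open>M\<close> have weight 0 and do not enter the eliminated
    equation. The value 1 keeps their coefficient nonzero and \<open>1 + b i * y\<close> positive at
    positive \<open>y\<close>.\<close>
  define b where "b i = (if i \<in> M then b0 i else 1)" for i
  have b_pos: "0 < b i" if "i \<notin> M \<inter> Od" for i
    using b0(1) that by (simp add: b_def)
  have b_neg: "b i < 0" if "i \<in> M \<inter> Od" for i
    using b0(2) that by (simp add: b_def)
  have b: "b i \<noteq> 0" for i using b_pos[of i] b_neg[of i] by (cases "i \<in> M \<inter> Od") auto
  have root: "y * (\<Prod>i\<in>N. (1 + b i * y)\<^sup>2) = (\<Prod>i\<in>P. (1 + b i * y)\<^sup>2)" if "y \<in> Y" for y
  proof -
    have "b i = b0 i" if "i \<in> P \<union> N" for i using that PN_M by (simp add: b_def)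
    then show ?thesis using Y(4)[OF that] by simp
  qed
  have pos: "0 < 1 + b i * y" if "y \<in> Y" "i \<notin> M \<inter> Od" for y i
    using b_pos[OF that(2)] Y(3)[OF that(1)] by (intro add_pos_pos) auto
  have nonzero: "1 + b i * y \<noteq> 0" if y: "y \<in> Y" for y i
  proof (cases "i \<in> M \<inter> Od")
    case True
    text \<open>All factors that can vanish at a positive point occur on the same side of the equation.\<close>
    have prod_pos: "0 < (\<Prod>i\<in>I. (1 + b i * y)\<^sup>2)" if "I \<inter> (M \<inter> Od) = {}" for I
      using pos[OF y] that by (intro prod_pos) (metis IntI empty_iff zero_less_power)
    from alt have "M \<inter> Od \<subseteq> N \<or> M \<inter> Od \<subseteq> P" by blast
    then show ?thesis
    proof
      assume sub: "M \<inter> Od \<subseteq> N"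
      have "0 < (\<Prod>i\<in>P. (1 + b i * y)\<^sup>2)" using sub PN(2) by (intro prod_pos) blast
      moreover have "(\<Prod>i\<in>N. (1 + b i * y)\<^sup>2) = 0" if "1 + b i * y = 0"
        using True sub that by (intro prod_zero bexI[of _ i]) auto
      ultimately show ?thesis using root[OF y] by (metis less_irrefl mult_zero_right)
    next
      assume sub: "M \<inter> Od \<subseteq> P"
      have "0 < (\<Prod>i\<in>N. (1 + b i * y)\<^sup>2)" using sub PN(2) by (intro prod_pos) blast
      moreover have "(\<Prod>i\<in>P. (1 + b i * y)\<^sup>2) = 0" if "1 + b i * y = 0"
        using True sub that by (intro prod_zero bexI[of _ i]) auto
      ultimately show ?thesis using root[OF y] Y(3)[OF y] by (metis less_irrefl mult_pos_pos)
    qed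
  qed (use pos[OF y, of i] in auto)
  \<comment> \<open>In either alternative of \<open>alt\<close>, \<open>d\<close> is the larger of
    the two degrees.\<close>
  have card_Y: "card Y = max (2 * card P) (2 * card N + 1)"
    using alt Y(2) by (auto simp: max_def)
  have "P \<union> N \<noteq> {}" using PN_M M(1) assms(1) by auto
  then interpret simplex_circuit Od P N
    using PN(2) by unfold_locales
  obtain t where t: "0 < t" "\<And>j. b j + t * (\<Sum>i\<in>UNIV. b i) \<noteq> 0"
    using exists_mixing_parameter[of b] b by blast
  have even_pos: "0 < 1 + b i * y" if "y \<in> Y" "i \<notin> Od" for y i
    using pos that by blast
  note system = t(1) b card_Y root even_pos nonzero
  have "card (real_sols (mixed_coeffs b t) circ) = 2 ^ (CARD('n) - R) * (m + min m R + 1)"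
    using card_real_sols[where b = b and Y = Y, OF system] M(2) Y(2) d by simp
  moreover have "generic_system (mixed_coeffs b t) circ"
    by (rule generic_system_coeffs[where b = b and Y = Y, OF system])
  moreover have "supported_on (mixed_coeffs b t) circ"
    by (rule supported_on_coeffs[OF t])
  moreover have "circuit_m circ = int m" using circuit_m_circ PN_M M(1) by simp
  moreover have "rk2 circ = R" using rk2_circ M(2) by simp
  ultimately show ?thesis
    using is_circuit_circ by (intro exI[of _ circ] exI[of _ "mixed_coeffs b t"]) (auto simp: min_def)
qed

end
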